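(* Let $\mathcal{H}$ be an infinite dimensional Hilbert space. Then $(Hol(B(\mathcal{H})^n_1),\rho)$ is a complete metric space and the Hausdorff derivations $$\frac{\partial}{\partial Z_i}:(Hol(B(\mathcal{H})^n_1),\rho)\to(Hol(B(\mathcal{H})^n_1),\rho),\qquad i=1,\ldots,n,$$ are continuous.
   Context: $\mathbb{F}_n^+$ is the unital free semigroup on generators $g_1,\ldots,g_n$ with identity $g_0$; $|\alpha|$ is word length; $X_\alpha:=X_{i_1}\cdots X_{i_k}$ if $\alpha=g_{i_1}\cdots g_{i_k}$, $X_{g_0}:=I$. $[B(\mathcal{H})^n]_1$ is the set of $[X_1,\ldots,X_n]\in B(\mathcal{H})^n$ with $\|\sum_iX_iX_i^*\|^{1/2}<1$, and $[B(\mathcal{H})^n]_r^-$ the set with $\|\sum_iX_iX_i^*\|^{1/2}\le r$. $Hol(B(\mathcal{H})^n_1)$ is the algebra of free holomorphic functions on $[B(\mathcal{H})^n]_1$ with scalar coefficients, i.e. functions $f:[B(\mathcal{H})^n]_1\to B(\mathcal{H})$ of the form $f(X_1,\ldots,X_n)=\sum_{k=0}^\infty\sum_{|\alpha|=k}a_\alpha X_\alpha$ (norm convergence), where $a_\alpha\in\mathbb{C}$ and $\limsup_{k\to\infty}(\sum_{|\alpha|=k}|a_\alpha|^2)^{1/2k}\le1$. Since $\mathcal{H}$ is infinite dimensional the coefficients are determined by $f$, and such functions are norm continuous. Metric: fix an increasing sequence $0<r_m<1$ with $r_m\to1$. For norm continuous $f,g:[B(\mathcal{H})^n]_1\to B(\mathcal{H})$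 and $0<r<1$, $\rho_r(f,g):=\sup_{X\in[B(\mathcal{H})^n]_r^-}\|f(X)-g(X)\|$ and $\rho(f,g):=\sum_{m=1}^\infty2^{-m}\frac{\rho_{r_m}(f,g)}{1+\rho_{r_m}(f,g)}$. The Hausdorff derivation $\frac{\partial}{\partial Z_i}$ is the linear derivation on noncommutative polynomials with $\frac{\partial I}{\partial Z_i}=0$, $\frac{\partial Z_j}{\partial Z_i}=\delta_{ij}I$ and the product rule, extended termwise to power series: $\frac{\partial}{\partial Z_i}\sum a_\alpha Z_\alpha=\sum a_\alpha\frac{\partial Z_\alpha}{\partial Z_i}$. It maps free holomorphic functions on the unit ball to free holomorphic functions on the unit ball. *)

theory Defs
  imports "HOL-Analysis.Analysis"
begin

section \<open>Complex Hilbert spaces and their bounded operators\<close>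

text \<open>The real inner product of a complex Hilbert space is the real part of the complex one, so
  norm, topology and completeness are those of the real Hilbert space.  The complex inner product
  is linear in its first argument.\<close>

class complex_hilbert = real_inner + complete_space +
  fixes scaleC :: "complex \<Rightarrow> 'a \<Rightarrow> 'a"  (infixr \<open>*\<^sub>C\<close> 75)
    and cinner :: "'a \<Rightarrow> 'a \<Rightarrow> complex"
  assumes scaleC_add_right: "c *\<^sub>C (x + y) = c *\<^sub>C x + c *\<^sub>C y"
    and scaleC_add_left: "(c + d) *\<^sub>C x = c *\<^sub>C x + d *\<^sub>C x"
    and scaleC_scaleC: "c *\<^sub>C d *\<^sub>C x = (c * d) *\<^sub>C x"
    and scaleC_one: "1 *\<^sub>C x = x"
    and scaleR_scaleC: "t *\<^sub>R x = complex_of_real t *\<^sub>C x"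
    and cinner_commute: "cinner x y = cnj (cinner y x)"
    and cinner_add_left: "cinner (x + y) z = cinner x z + cinner y z"
    and cinner_scaleC_left: "cinner (c *\<^sub>C x) y = c * cinner x y"
    and inner_eq_Re_cinner: "x \<bullet> y = Re (cinner x y)"

global_interpretation complex_vector:
  vector_space "scaleC :: complex \<Rightarrow> 'a \<Rightarrow> 'a::complex_hilbert"
  by unfold_locales (simp_all add: scaleC_add_right scaleC_add_left scaleC_scaleC scaleC_one)

lemma norm_scaleC: "norm (c *\<^sub>C x) = cmod c * norm (x::'a::complex_hilbert)"
proof -
  have "cinner (c *\<^sub>C x) (c *\<^sub>C x) = c * cnj c * cinner x x"
    by (metis cinner_commute cinner_scaleC_left complex_cnj_mult mult.assoc)
  then have "cinner (c *\<^sub>C x) (c *\<^sub>C x) = complex_of_real ((cmod c)\<^sup>2) * cinner x x"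
    by (simp add: complex_norm_square del: of_real_power)
  then have "(norm (c *\<^sub>C x))\<^sup>2 = (cmod c * norm x)\<^sup>2"
    by (simp add: power2_norm_eq_inner inner_eq_Re_cinner power_mult_distrib)
  then show ?thesis
    by simp
qed

lemma bounded_linear_scaleC: "bounded_linear (\<lambda>x::'a::complex_hilbert. c *\<^sub>C x)"
  by (rule bounded_linear_intro[where K = "cmod c"])
    (simp_all add: scaleC_add_right scaleR_scaleC scaleC_scaleC norm_scaleC mult.commute)

lift_definition scaleC_op ::
  "complex \<Rightarrow> ('h \<Rightarrow>\<^sub>L 'h) \<Rightarrow> ('h \<Rightarrow>\<^sub>L 'h::complex_hilbert)"
  is "\<lambda>c T x. c *\<^sub>C T x"
  by (rule bounded_linear_compose[OF bounded_linear_scaleC])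

text \<open>\<open>'h \<Rightarrow>\<^sub>L 'h\<close> consists of the real-linear bounded operators; its norm is the operator norm.\<close>

definition bounded_ops :: "('h::complex_hilbert \<Rightarrow>\<^sub>L 'h) set" where
  "bounded_ops = {T. \<forall>c x. blinfun_apply T (c *\<^sub>C x) = c *\<^sub>C blinfun_apply T x}"

definition adjoint_op :: "('h \<Rightarrow>\<^sub>L 'h) \<Rightarrow> ('h \<Rightarrow>\<^sub>L 'h::complex_hilbert)" where
  "adjoint_op T =
    (THE S. \<forall>x y. cinner (blinfun_apply T x) y = cinner x (blinfun_apply S y))"

section \<open>Free holomorphic functions on the unit ball\<close>

text \<open>Words over the index type \<open>'n\<close> (of cardinality $n$) are lists.\<close>

primrec word_op :: "('h \<Rightarrow>\<^sub>L 'h::complex_hilbert) ^ 'n \<Rightarrow> 'n list \<Rightarrow> ('h \<Rightarrow>\<^sub>L 'h)" where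
  "word_op X [] = id_blinfun"
| "word_op X (i # \<alpha>) = X $ i o\<^sub>L word_op X \<alpha>"

definition row_norm :: "('h \<Rightarrow>\<^sub>L 'h::complex_hilbert) ^ 'n \<Rightarrow> real" where
  "row_norm X = sqrt (norm (\<Sum>i\<in>UNIV. X $ i o\<^sub>L adjoint_op (X $ i)))"

definition op_ball :: "(('h \<Rightarrow>\<^sub>L 'h::complex_hilbert) ^ 'n) set" where
  "op_ball = {X. (\<forall>i. X $ i \<in> bounded_ops) \<and> row_norm X < 1}"

definition op_cball :: "real \<Rightarrow> (('h \<Rightarrow>\<^sub>L 'h::complex_hilbert) ^ 'n) set" where
  "op_cball r = {X. (\<forall>i. X $ i \<in> bounded_ops) \<and> row_norm X \<le> r}"

text \<open>A formal power series $\sum_\alpha a_\alpha Z_\alpha$ in noncommuting indeterminates is given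
  by its coefficients; polynomials are the finitely supported ones.\<close>

type_synonym 'n ncseries = "'n list \<Rightarrow> complex"

definition hom_part ::
  "'n::finite ncseries \<Rightarrow> nat \<Rightarrow> ('h \<Rightarrow>\<^sub>L 'h::complex_hilbert) ^ 'n \<Rightarrow> ('h \<Rightarrow>\<^sub>L 'h)" where
  "hom_part a k X = (\<Sum>\<alpha> | length \<alpha> = k. scaleC_op (a \<alpha>) (word_op X \<alpha>))"

type_synonym ('h, 'n) op_fun = "('h \<Rightarrow>\<^sub>L 'h, 'n) vec \<Rightarrow> ('h \<Rightarrow>\<^sub>L 'h)"

definition has_free_series ::
  "('h::complex_hilbert, 'n::finite) op_fun \<Rightarrow> 'n ncseries \<Rightarrow> bool" where
  "has_free_series f a \<longleftrightarrow>
    limsup (\<lambda>k. ereal (root (2 * k) (\<Sum>\<alpha> | length \<alpha> = k. (cmod (a \<alpha>))\<^sup>2))) \<le> 1 \<and>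
    (\<forall>X\<in>op_ball. (\<lambda>k. hom_part a k X) sums f X)"

text \<open>Functions on the ball are represented by functions that are \<open>undefined\<close> outside of it,
  so that equality is equality on the ball.\<close>

definition Hol :: "('h::complex_hilbert, 'n::finite) op_fun set" where
  "Hol = {f \<in> op_ball \<rightarrow>\<^sub>E bounded_ops. \<exists>a. has_free_series f a}"

text \<open>The coefficients are uniquely determined by the function when \<open>'h\<close> is infinite
  dimensional.\<close>

definition free_coeffs ::
  "('h::complex_hilbert, 'n::finite) op_fun \<Rightarrow> 'n ncseries" where
  "free_coeffs f = (THE a. has_free_series f a)"

section \<open>The metric\<close>

text \<open>The supremum is finite for \<open>f\<close> and \<open>g\<close> in \<open>Hol\<close> and \<open>r < 1\<close>.\<close>

definition rho_at :: "real \<Rightarrow> ('h::complex_hilbert, 'n::finite) op_fun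
    \<Rightarrow> ('h, 'n) op_fun \<Rightarrow> real" where
  "rho_at r f g = (SUP X\<in>op_cball r. norm (f X - g X))"

text \<open>The radii are indexed from 0, hence the weights $2^{-(m+1)}$.\<close>

definition rho :: "(nat \<Rightarrow> real) \<Rightarrow> ('h::complex_hilbert, 'n::finite) op_fun
    \<Rightarrow> ('h, 'n) op_fun \<Rightarrow> real" where
  "rho r f g = (\<Sum>m. (1 / 2) ^ Suc m * (rho_at (r m) f g / (1 + rho_at (r m) f g)))"

text \<open>The locale \<open>Metric_space\<close> demands nonnegativity and symmetry for all arguments, also outside
  of the carrier, where \<open>rho\<close> may be meaningless; hence the restriction to \<open>Hol\<close>.\<close>

definition Hol_dist ::
  "(nat \<Rightarrow> real) \<Rightarrow> ('h::complex_hilbert, 'n::finite) op_fun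
    \<Rightarrow> ('h, 'n) op_fun \<Rightarrow> real" where
  "Hol_dist r f g = (if f \<in> Hol \<and> g \<in> Hol then rho r f g else 0)"

section \<open>Hausdorff derivations\<close>

definition nc_monom :: "'n list \<Rightarrow> 'n ncseries" where
  "nc_monom \<alpha> = (\<lambda>\<beta>. if \<beta> = \<alpha> then 1 else 0)"

definition nc_mult :: "'n ncseries \<Rightarrow> 'n ncseries \<Rightarrow> 'n ncseries" where
  "nc_mult f g = (\<lambda>\<gamma>. \<Sum>k\<le>length \<gamma>. f (take k \<gamma>) * g (drop k \<gamma>))"

text \<open>$\partial Z_\alpha / \partial Z_i$, by the product rule for $Z_j Z_\beta$.\<close>

primrec word_deriv :: "'n \<Rightarrow> 'n list \<Rightarrow> 'n ncseries" where
  "word_deriv i [] = (\<lambda>_. 0)"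
| "word_deriv i (j # \<beta>) =
    (\<lambda>\<gamma>. (if j = i then nc_monom \<beta> \<gamma> else 0) + nc_mult (nc_monom [j]) (word_deriv i \<beta>) \<gamma>)"

text \<open>Termwise extension.  Only words \<open>\<alpha>\<close> one letter longer than \<open>\<beta>\<close> contribute to the
  coefficient at \<open>\<beta>\<close>, see \<open>word_deriv_eq_0\<close>, so the sum over all words reduces to a finite one.\<close>

definition series_deriv :: "'n \<Rightarrow> 'n::finite ncseries \<Rightarrow> 'n ncseries" where
  "series_deriv i a = (\<lambda>\<beta>. \<Sum>\<alpha> | length \<alpha> = Suc (length \<beta>). a \<alpha> * word_deriv i \<alpha> \<beta>)"

definition hausdorff_deriv :: "'n \<Rightarrow> ('h::complex_hilbert, 'n::finite) op_fun
    \<Rightarrow> ('h, 'n) op_fun" where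
  "hausdorff_deriv i f =
    (\<lambda>X\<in>op_ball. \<Sum>k. hom_part (series_deriv i (free_coeffs f)) k X)"

lemma nc_mult_letter_Nil [simp]: "nc_mult (nc_monom [j]) f [] = 0"
  by (simp add: nc_mult_def nc_monom_def)

lemma nc_mult_letter_Cons [simp]:
  "nc_mult (nc_monom [j]) f (x # \<gamma>) = (if x = j then f \<gamma> else 0)"
proof -
  have "nc_mult (nc_monom [j]) f (x # \<gamma>) =
      (\<Sum>k\<le>length \<gamma>. (if x = j \<and> take k \<gamma> = [] then 1 else 0) * f (drop k \<gamma>))"
    unfolding nc_mult_def nc_monom_def
    by (simp add: sum.atMost_Suc_shift del: sum.atMost_Suc)
  also have "\<dots> = (\<Sum>k\<le>length \<gamma>. if k = 0 then (if x = j then f \<gamma> else 0) else 0)"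
    by (rule sum.cong) auto
  finally show ?thesis
    by simp
qed

lemma nc_monom_eq_0: "length \<alpha> \<noteq> length \<beta> \<Longrightarrow> nc_monom \<alpha> \<beta> = 0"
  by (auto simp: nc_monom_def)

lemma word_deriv_eq_0: "length \<alpha> \<noteq> Suc (length \<beta>) \<Longrightarrow> word_deriv i \<alpha> \<beta> = 0"
proof (induction \<alpha> arbitrary: \<beta>)
  case (Cons j \<alpha>)
  then show ?case
    by (cases \<beta>) (auto simp: nc_monom_eq_0)
qed simp

lemma nc_mult_Cons:
  "nc_mult f g (x # \<gamma>) = f [] * g (x # \<gamma>) + nc_mult (\<lambda>\<delta>. f (x # \<delta>)) g \<gamma>"
  by (simp add: nc_mult_def sum.atMost_Suc_shift del: sum.atMost_Suc)

lemma nc_mult_letter_assoc: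
  "nc_mult (nc_mult (nc_monom [j]) f) g = nc_mult (nc_monom [j]) (nc_mult f g)"
proof
  fix \<gamma>
  show "nc_mult (nc_mult (nc_monom [j]) f) g \<gamma> = nc_mult (nc_monom [j]) (nc_mult f g) \<gamma>"
  proof (cases \<gamma>)
    case Nil
    then show ?thesis by (simp add: nc_mult_def nc_monom_def)
  next
    case (Cons x \<delta>)
    then show ?thesis
      by (cases "x = j") (simp_all add: nc_mult_Cons[of "nc_mult (nc_monom [j]) f"],
        simp add: nc_mult_def)
  qed
qed

lemma nc_mult_monom_Nil [simp]: "nc_mult (nc_monom []) f = f"
proof
  fix \<gamma>
  have "nc_mult (nc_monom []) f \<gamma> = (\<Sum>k\<le>length \<gamma>. if k = 0 then f \<gamma> else 0)"
    unfolding nc_mult_def nc_monom_def by (rule sum.cong) auto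
  then show "nc_mult (nc_monom []) f \<gamma> = f \<gamma>"
    by simp
qed

lemma nc_monom_Cons: "nc_monom (j # \<alpha>) = nc_mult (nc_monom [j]) (nc_monom \<alpha>)"
proof
  fix \<gamma>
  show "nc_monom (j # \<alpha>) \<gamma> = nc_mult (nc_monom [j]) (nc_monom \<alpha>) \<gamma>"
    by (cases \<gamma>) (simp_all, simp_all add: nc_monom_def)
qed

lemma nc_mult_monom: "nc_mult (nc_monom \<alpha>) (nc_monom \<beta>) = nc_monom (\<alpha> @ \<beta>)"
proof (induction \<alpha>)
  case (Cons j \<alpha>)
  then show ?case
    by (simp only: append_Cons nc_monom_Cons[of j \<alpha>]
        nc_monom_Cons[of j "\<alpha> @ \<beta>"] nc_mult_letter_assoc)
qed simp

lemma nc_mult_add_left: "nc_mult (\<lambda>\<gamma>. f \<gamma> + g \<gamma>) h \<gamma> = nc_mult f h \<gamma> + nc_mult g h \<gamma>"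
  by (simp add: nc_mult_def distrib_right sum.distrib)

lemma nc_mult_add_right: "nc_mult h (\<lambda>\<gamma>. f \<gamma> + g \<gamma>) \<gamma> = nc_mult h f \<gamma> + nc_mult h g \<gamma>"
  by (simp add: nc_mult_def distrib_left sum.distrib)

text \<open>\<open>word_deriv\<close> satisfies the defining properties of the Hausdorff derivation on monomials and
  is determined by them.\<close>

lemma word_deriv_letter: "word_deriv i [j] = (if j = i then nc_monom [] else (\<lambda>_. 0))"
proof
  fix \<gamma>
  show "word_deriv i [j] \<gamma> = (if j = i then nc_monom [] else (\<lambda>_. 0)) \<gamma>"
    by (cases \<gamma>) auto
qed

lemma word_deriv_append:
  "word_deriv i (\<alpha> @ \<beta>) =
    (\<lambda>\<gamma>. nc_mult (word_deriv i \<alpha>) (nc_monom \<beta>) \<gamma> + nc_mult (nc_monom \<alpha>) (word_deriv i \<beta>) \<gamma>)"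
proof (induction \<alpha>)
  case Nil
  then show ?case
    by (simp add: nc_mult_def[of "\<lambda>_. 0"])
next
  case (Cons j \<alpha>)
  have *: "nc_mult (\<lambda>\<gamma>. if j = i then nc_monom \<alpha> \<gamma> else 0) (nc_monom \<beta>) \<gamma>
      = (if j = i then nc_monom (\<alpha> @ \<beta>) \<gamma> else 0)" for \<gamma>
    using nc_mult_monom[of \<alpha> \<beta>] by (cases "j = i") (simp_all add: nc_mult_def[of "\<lambda>_. 0"])
  show ?case
    by (rule ext) (simp only: append_Cons word_deriv.simps Cons.IH nc_monom_Cons[of j \<alpha>] *
        nc_mult_add_left nc_mult_add_right nc_mult_letter_assoc add.assoc)
qed

lemma series_deriv_monom: "series_deriv i (nc_monom \<alpha>) = word_deriv i (\<alpha> :: 'n::finite list)"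
proof
  fix \<beta> :: "'n list"
  have fin: "finite {\<alpha>' :: 'n list. length \<alpha>' = Suc (length \<beta>)}"
    using finite_lists_length_eq[of "UNIV :: 'n set" "Suc (length \<beta>)"] by simp
  have "series_deriv i (nc_monom \<alpha>) \<beta> =
      (\<Sum>\<alpha>' | length \<alpha>' = Suc (length \<beta>). if \<alpha>' = \<alpha> then word_deriv i \<alpha> \<beta> else 0)"
    unfolding series_deriv_def nc_monom_def by (rule sum.cong) auto
  then show "series_deriv i (nc_monom \<alpha>) \<beta> = word_deriv i \<alpha> \<beta>"
    using fin by (simp add: word_deriv_eq_0)
qed

lemma word_deriv_unique:
  assumes "D [] = (\<lambda>_. 0)"
    and "\<And>j. D [j] = (if j = i then nc_monom [] else (\<lambda>_. 0))"
    and "\<And>\<alpha> \<beta>. D (\<alpha> @ \<beta>) =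
      (\<lambda>\<gamma>. nc_mult (D \<alpha>) (nc_monom \<beta>) \<gamma> + nc_mult (nc_monom \<alpha>) (D \<beta>) \<gamma>)"
  shows "D \<alpha> = word_deriv i \<alpha>"
proof (induction \<alpha>)
  case (Cons j \<alpha>)
  show ?case
    using assms(3)[of "[j]" \<alpha>] word_deriv_append[of i "[j]" \<alpha>] assms(2)[of j]
      word_deriv_letter[of i j] Cons.IH
    by simp
qed (simp add: assms(1))

end

theory Submission
  imports Defs
begin

text \<open>Write \<open>N\<^sub>k a\<close> for the $\ell^2$ norm of the coefficients of \<open>a\<close> at words of length \<open>k\<close>, and
  \<open>\<parallel>f\<parallel>\<^sub>t\<close> for the supremum of \<open>f\<close> over the closed ball of radius \<open>t\<close>.  Since the row of all
  \<open>X\<^sub>\<alpha>\<close> with \<open>|\<alpha>| = k\<close> has norm at most \<open>t\<^sup>k\<close> on that ball, \<open>\<parallel>f\<parallel>\<^sub>t \<le> \<Sum>\<^sub>k t\<^sup>k N\<^sub>k a\<close>.  Conversely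
  \<open>t\<^sup>k N\<^sub>k a \<le> \<parallel>f\<parallel>\<^sub>t\<close>: as the Hilbert space is infinite dimensional, it contains an orthonormal
  family \<open>e\<^sub>\<alpha>\<close> indexed by the words of length at most \<open>k\<close>; if \<open>X\<^sub>i\<close> maps \<open>e\<^sub>\<alpha>\<close> to \<open>t e\<^sub>i\<^sub>\<alpha>\<close> for
  \<open>|\<alpha>| < k\<close> and vanishes on the orthogonal complement, then \<open>f(X)\<close> applied to the vector of the empty
  word has \<open>e\<^sub>\<alpha>\<close>-coordinate \<open>t\<^sup>k a\<^sub>\<alpha>\<close> for \<open>|\<alpha>| = k\<close>.  So convergence in the metric is convergence in
  all the norms \<open>sup\<^sub>k t\<^sup>k N\<^sub>k\<close> with \<open>t < 1\<close>.  Completeness follows coefficientwise, and continuity of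
  the derivations from \<open>N\<^sub>k (\<partial>a/\<partial>Z\<^sub>i) \<le> (k + 1) N\<^sub>k\<^sub>+\<^sub>1 a\<close> at the cost of slightly enlarging \<open>t\<close>.\<close>

subsection \<open>Complex Hilbert spaces\<close>

instance complex_hilbert \<subseteq> banach ..

lemma cinner_add_right: "cinner x (y + z) = cinner x y + cinner x (z::'a::complex_hilbert)"
  by (metis cinner_add_left cinner_commute complex_cnj_add)

lemma cinner_scaleC_right: "cinner x (c *\<^sub>C y) = cnj c * cinner x (y::'a::complex_hilbert)"
  by (metis cinner_commute cinner_scaleC_left complex_cnj_mult)

lemma cinner_zero_left [simp]: "cinner 0 (x::'a::complex_hilbert) = 0"
  using cinner_add_left[of 0 0 x] by simp

lemma cinner_zero_right [simp]: "cinner (x::'a::complex_hilbert) 0 = 0"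
  using cinner_add_right[of x 0 0] by simp

lemma cinner_minus_left: "cinner (- x) y = - cinner x (y::'a::complex_hilbert)"
  by (metis add.right_inverse add_eq_0_iff cinner_add_left cinner_zero_left)

lemma cinner_diff_left: "cinner (x - y) z = cinner x z - cinner y (z::'a::complex_hilbert)"
  using cinner_add_left[of x "- y" z] by (simp add: cinner_minus_left)

lemma cinner_sum_left: "cinner (sum f A) (y::'a::complex_hilbert) = (\<Sum>i\<in>A. cinner (f i) y)"
  by (induction A rule: infinite_finite_induct) (simp_all add: cinner_add_left)

lemma cinner_sum_right: "cinner (y::'a::complex_hilbert) (sum f A) = (\<Sum>i\<in>A. cinner y (f i))"
  by (induction A rule: infinite_finite_induct) (simp_all add: cinner_add_right)

lemma cinner_self: "cinner x (x::'a::complex_hilbert) = complex_of_real ((norm x)\<^sup>2)"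
proof (rule complex_eqI)
  show "Re (cinner x x) = Re (complex_of_real ((norm x)\<^sup>2))"
    by (simp only: Re_complex_of_real power2_norm_eq_inner inner_eq_Re_cinner)
  show "Im (cinner x x) = Im (complex_of_real ((norm x)\<^sup>2))"
    by (metis Im_complex_of_real Reals_cnj_iff cinner_commute complex_is_Real_iff)
qed

text \<open>Rotating \<open>x\<close> by a phase makes the complex inner product real and
  nonnegative, so the real Cauchy-Schwarz inequality applies.\<close>

lemma norm_cinner_le: "cmod (cinner x y) \<le> norm x * norm (y::'a::complex_hilbert)"
proof -
  \<comment> \<open>The case distinction keeps \<open>c\<close> unimodular, since
    \<open>sgn 0 = 0\<close>.\<close>
  define c where "c = (if cinner x y = 0 then 1 else cnj (sgn (cinner x y)))"
  have c1: "cmod c = 1"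
    by (simp add: c_def norm_sgn)
  have "c * cinner x y = complex_of_real (cmod (cinner x y))"
    using complex_norm_square[of "cinner x y"]
    by (simp add: c_def sgn_eq power2_eq_square field_simps)
  then have "cmod (cinner x y) = (c *\<^sub>C x) \<bullet> y"
    by (simp add: inner_eq_Re_cinner cinner_scaleC_left)
  also have "\<dots> \<le> norm (c *\<^sub>C x) * norm y"
    by (rule norm_cauchy_schwarz)
  finally show ?thesis
    by (simp add: norm_scaleC c1)
qed

lemma bounded_linear_cinner_left: "bounded_linear (\<lambda>x::'a::complex_hilbert. cinner x y)"
  by (rule bounded_linear_intro[where K = "norm y"])
    (simp_all add: cinner_add_left scaleR_scaleC cinner_scaleC_left norm_cinner_le
      scaleR_conv_of_real)

text \<open>Lets identities between real inner products be lifted to complex ones by rotating the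
  first argument.\<close>

lemma Im_cinner: "Im (cinner x y) = Re (cinner ((- \<i>) *\<^sub>C x) (y::'a::complex_hilbert))"
  by (simp add: cinner_scaleC_left cinner_minus_left)

text \<open>The functional \<open>\<phi>\<close> is represented by the minimizer of \<open>\<parallel>x\<parallel>\<^sup>2 - 2 \<phi> x\<close>; minimizing
  sequences are Cauchy by the parallelogram law.\<close>

lemma Riesz_representation:
  fixes \<phi> :: "'a::{real_inner, banach} \<Rightarrow> real"
  assumes "bounded_linear \<phi>"
  obtains z where "\<And>x. \<phi> x = x \<bullet> z"
proof -
  interpret \<phi>: bounded_linear \<phi> by fact
  define J where "J = (\<lambda>x. x \<bullet> x - 2 * \<phi> x)"
  obtain K where K: "\<And>x. norm (\<phi> x) \<le> norm x * K"
    using \<phi>.bounded by blast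
  \<comment> \<open>Completing the square: \<open>J x\<close> is at least
    \<open>(norm x - K)\<^sup>2 - K\<^sup>2\<close>.\<close>
  have low: "- K\<^sup>2 \<le> J x" for x
  proof -
    have "\<phi> x \<le> norm x * K"
      using K[of x] by simp
    moreover have "0 \<le> (norm x - K)\<^sup>2"
      by simp
    ultimately show ?thesis
      by (simp add: J_def power2_diff power2_norm_eq_inner)
  qed
  then have bdd: "bdd_below (range J)"
    by (auto intro!: bdd_belowI[of _ "- K\<^sup>2"])
  define d where "d = Inf (range J)"
  have d_le: "d \<le> J x" for x
    unfolding d_def by (rule cInf_lower[OF _ bdd]) simp
  have "\<exists>x. J x < d + 1 / (real n + 1)" for n
    using cInf_lessD[of "range J" "d + 1 / (real n + 1)"] by (auto simp: d_def add_pos_nonneg)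
  then obtain u where u: "\<And>n. J (u n) < d + 1 / (real n + 1)"
    by metis
  \<comment> \<open>The parallelogram law for \<open>x\<close> and \<open>y\<close>, combined with
    the lower bound \<open>d\<close> at their midpoint.\<close>
  have par: "(norm (x - y))\<^sup>2 \<le> 2 * (J x - d) + 2 * (J y - d)" for x y
  proof -
    have "(norm (x - y))\<^sup>2 = 2 * J x + 2 * J y - 4 * J ((1/2) *\<^sub>R (x + y))"
      unfolding power2_norm_eq_inner J_def
      by (simp add: inner_diff_left inner_diff_right inner_add_left inner_add_right
        \<phi>.scaleR \<phi>.add inner_commute algebra_simps)
    then show ?thesis
      using d_le[of "(1/2) *\<^sub>R (x + y)"] by simp
  qed
  have "Cauchy u"
  proof (rule metric_CauchyI)
    fix e :: real assume "0 < e"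
    then obtain N where N: "inverse (real (Suc N)) < e\<^sup>2 / 4"
      using reals_Archimedean[of "e\<^sup>2 / 4"] by auto
    have Ju: "J (u m) - d < e\<^sup>2 / 4" if "m \<ge> N" for m
    proof -
      have "1 / (real m + 1) \<le> inverse (real (Suc N))"
        using that by (simp add: field_simps)
      then show ?thesis
        using u[of m] N by simp
    qed
    have "dist (u m) (u n) < e" if "m \<ge> N" "n \<ge> N" for m n
    proof -
      have "(norm (u m - u n))\<^sup>2 < e\<^sup>2"
        using par[of "u m" "u n"] Ju[OF that(1)] Ju[OF that(2)] by simp
      then show ?thesis
        using \<open>0 < e\<close> by (simp add: dist_norm power_less_imp_less_base)
    qed
    then show "\<exists>N. \<forall>m\<ge>N. \<forall>n\<ge>N. dist (u m) (u n) < e"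
      by blast
  qed
  then obtain z where z: "u \<longlonglongrightarrow> z"
    by (auto simp: Cauchy_convergent_iff convergent_def)
  have "(\<lambda>n. J (u n)) \<longlonglongrightarrow> J z"
    unfolding J_def by (intro tendsto_intros z \<phi>.tendsto)
  moreover have "(\<lambda>n. d + 1 / (real n + 1)) \<longlonglongrightarrow> d + 0"
    by (intro tendsto_intros) (use LIMSEQ_Suc[OF lim_1_over_n] in \<open>simp add: add.commute\<close>)
  ultimately have "J z \<le> d + 0"
    by (rule LIMSEQ_le) (use u in \<open>auto intro: less_imp_le\<close>)
  then have min: "J z \<le> J x" for x
    using d_le[of x] by simp
  have "\<phi> x = x \<bullet> z" for x
  proof -
    \<comment> \<open>\<open>2 * b\<close> is the derivative of \<open>J\<close> at \<open>z\<close>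
      in direction \<open>x\<close>, which has to vanish at a minimum.\<close>
    define b where "b = x \<bullet> z - \<phi> x"
    have quad: "0 \<le> t\<^sup>2 * (x \<bullet> x) + 2 * t * b" for t
      using min[of "z + t *\<^sub>R x"]
      by (simp add: J_def b_def inner_add_left inner_add_right \<phi>.add \<phi>.scaleR inner_commute
        algebra_simps power2_eq_square)
    have "b = 0"
    proof (cases "x = 0")
      case True
      then show ?thesis by (simp add: b_def \<phi>.zero)
    next
      case False
      then have "x \<bullet> x > 0" by simp
      \<comment> \<open>The value \<open>- b / (x \<bullet> x)\<close> of \<open>t\<close> minimizes
        the quadratic polynomial in \<open>quad\<close>.\<close>
      moreover have "0 \<le> - (b\<^sup>2 / (x \<bullet> x))"
        using quad[of "- b / (x \<bullet> x)"] \<open>x \<bullet> x > 0\<close>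
        by (simp add: power2_eq_square field_simps)
      ultimately have "b\<^sup>2 \<le> 0"
        by (simp add: divide_le_0_iff not_le[symmetric])
      then show ?thesis by simp
    qed
    then show ?thesis by (simp add: b_def)
  qed
  then show thesis by (rule that)
qed

section \<open>Adjoints of complex-linear operators\<close>

lemma bounded_ops_scaleC:
  "T \<in> bounded_ops \<Longrightarrow> blinfun_apply T (c *\<^sub>C x) = c *\<^sub>C blinfun_apply T x"
  by (simp add: bounded_ops_def)

text \<open>Justifies the definite description in \<open>adjoint_op\<close>: Riesz representation
  yields the adjoint for the real inner product, complex linearity of \<open>T\<close> extends the
  identity to imaginary parts, and nondegeneracy of the inner product gives uniqueness.\<close>

lemma cinner_adjoint_op:
  fixes T :: "'h::complex_hilbert \<Rightarrow>\<^sub>L 'h"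
  assumes T: "T \<in> bounded_ops"
  shows "cinner (T x) y = cinner x (adjoint_op T y)"
proof -
  have "\<exists>z. \<forall>x. T x \<bullet> y = x \<bullet> z" for y
  proof -
    have "bounded_linear (\<lambda>x. T x \<bullet> y)"
      by (intro bounded_linear_intros)
    from Riesz_representation[OF this] show ?thesis
      by metis
  qed
  then obtain S where S: "\<And>x y. T x \<bullet> y = x \<bullet> S y"
    by metis
  have "bounded_linear S"
  proof (rule bounded_linear_intro[where K = "norm T"])
    show "S (x + y) = S x + S y" for x y
      by (rule vector_eq_ldot[THEN iffD1]) (simp add: S[symmetric] inner_add_right)
    show "S (t *\<^sub>R x) = t *\<^sub>R S x" for t x
      by (rule vector_eq_ldot[THEN iffD1]) (simp add: S[symmetric])
    show "norm (S x) \<le> norm x * norm T" for x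
    proof -
      have "norm (S x) * norm (S x) = T (S x) \<bullet> x"
        by (simp add: S power2_norm_eq_inner[symmetric] power2_eq_square)
      also have "\<dots> \<le> norm (T (S x)) * norm x"
        by (rule norm_cauchy_schwarz)
      also have "\<dots> \<le> (norm T * norm (S x)) * norm x"
        by (intro mult_right_mono norm_blinfun) simp
      finally show ?thesis
        by (cases "S x = 0") (simp_all add: mult.commute mult.left_commute)
    qed
  qed
  then have ap: "blinfun_apply (Blinfun S) = S"
    by (rule bounded_linear_Blinfun_apply)
  have adj: "cinner (T x) y = cinner x (Blinfun S y)" for x y
  proof (rule complex_eqI)
    show "Re (cinner (T x) y) = Re (cinner x (Blinfun S y))"
      using S[of x y] by (simp add: ap inner_eq_Re_cinner)
    show "Im (cinner (T x) y) = Im (cinner x (Blinfun S y))"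
      unfolding Im_cinner using S[of "(- \<i>) *\<^sub>C x" y] T
      by (simp add: ap inner_eq_Re_cinner bounded_ops_scaleC blinfun.minus_right)
  qed
  have "\<forall>x y. cinner (T x) y = cinner x (adjoint_op T y)"
    unfolding adjoint_op_def
  proof (rule theI[where a = "Blinfun S"])
    show "\<forall>x y. cinner (T x) y = cinner x (Blinfun S y)"
      using adj by blast
    fix S' assume S': "\<forall>x y. cinner (T x) y = cinner x (blinfun_apply S' y)"
    show "S' = Blinfun S"
    proof (rule blinfun_eqI)
      fix y
      show "S' y = Blinfun S y"
        using S' by (intro vector_eq_ldot[THEN iffD1]) (simp add: inner_eq_Re_cinner adj[symmetric])
    qed
  qed
  then show ?thesis by blast
qed

subsection \<open>Row contractions\<close>

lemma inner_adjoint_op: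
  "T \<in> bounded_ops \<Longrightarrow> blinfun_apply T x \<bullet> y = x \<bullet> blinfun_apply (adjoint_op T) y"
  by (simp add: inner_eq_Re_cinner cinner_adjoint_op)

text \<open>Cauchy-Schwarz in the direct sum of copies of the space.\<close>

lemma inner_L2_set_le:
  fixes u v :: "'i \<Rightarrow> 'a::real_inner"
  shows "(\<Sum>i\<in>A. u i \<bullet> v i) \<le> L2_set (\<lambda>i. norm (u i)) A * L2_set (\<lambda>i. norm (v i)) A"
proof -
  have "(\<Sum>i\<in>A. u i \<bullet> v i) \<le> (\<Sum>i\<in>A. \<bar>norm (u i)\<bar> * \<bar>norm (v i)\<bar>)"
    by (intro sum_mono) (simp add: norm_cauchy_schwarz)
  also have "\<dots> \<le> L2_set (\<lambda>i. norm (u i)) A * L2_set (\<lambda>i. norm (v i)) A"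
    by (rule L2_set_mult_ineq)
  finally show ?thesis .
qed

lemma mult_self_le_imp_le: "a * a \<le> b * a \<Longrightarrow> 0 \<le> b \<Longrightarrow> 0 \<le> a \<Longrightarrow> a \<le> (b::real)"
  by (metis mult_right_le_imp_le order.order_iff_strict)

text \<open>The C*-identity for the row acting on tuples \<open>h\<close>: its squared norm is the
  norm of the row times its adjoint. It turns membership in \<open>op_cball\<close> into an
  inequality free of adjoints.\<close>

lemma row_norm_le_iff:
  fixes X :: "('h::complex_hilbert \<Rightarrow>\<^sub>L 'h) ^ 'n::finite"
  assumes X: "\<And>i. X $ i \<in> bounded_ops" and s: "0 \<le> s"
  shows "row_norm X \<le> s \<longleftrightarrow>
    (\<forall>h. norm (\<Sum>i\<in>UNIV. (X $ i) (h i)) \<le> s * L2_set (\<lambda>i. norm (h i)) UNIV)"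
proof -
  define P where "P = (\<Sum>i\<in>UNIV. X $ i o\<^sub>L adjoint_op (X $ i))"
  have Py: "P y = (\<Sum>i\<in>UNIV. (X $ i) (adjoint_op (X $ i) y))" for y
    by (simp add: P_def blinfun.sum_left)
  \<comment> \<open>\<open>P\<close> is the row times its adjoint column, so
    \<open>P y \<bullet> y\<close> is the squared norm of the column at \<open>y\<close>.\<close>
  have L2adj: "(L2_set (\<lambda>i. norm (adjoint_op (X $ i) y)) UNIV)\<^sup>2 = P y \<bullet> y" for y
    by (simp add: L2_set_def sum_nonneg Py inner_sum_left inner_adjoint_op[OF X]
        power2_norm_eq_inner)
  have "row_norm X \<le> s \<longleftrightarrow> norm P \<le> s\<^sup>2"
    unfolding row_norm_def P_def[symmetric]
    using s by (metis real_sqrt_le_iff real_sqrt_unique)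
  also have "\<dots> \<longleftrightarrow> (\<forall>h. norm (\<Sum>i\<in>UNIV. (X $ i) (h i)) \<le> s * L2_set (\<lambda>i. norm (h i)) UNIV)"
  proof
    assume P: "norm P \<le> s\<^sup>2"
    have adj: "L2_set (\<lambda>i. norm (adjoint_op (X $ i) y)) UNIV \<le> s * norm y" for y
    proof (rule power2_le_imp_le)
      have "P y \<bullet> y \<le> norm (P y) * norm y"
        by (rule norm_cauchy_schwarz)
      also have "\<dots> \<le> (s\<^sup>2 * norm y) * norm y"
        by (intro mult_right_mono order_trans[OF norm_blinfun] P) simp_all
      finally show "(L2_set (\<lambda>i. norm (adjoint_op (X $ i) y)) UNIV)\<^sup>2 \<le> (s * norm y)\<^sup>2"
        unfolding L2adj by (simp add: power2_eq_square algebra_simps)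
    qed (use s in simp)
    show "\<forall>h. norm (\<Sum>i\<in>UNIV. (X $ i) (h i)) \<le> s * L2_set (\<lambda>i. norm (h i)) UNIV"
    proof
      fix h :: "'n \<Rightarrow> 'h"
      define v where "v = (\<Sum>i\<in>UNIV. (X $ i) (h i))"
      have "norm v * norm v = v \<bullet> v"
        by (simp add: power2_norm_eq_inner[symmetric] power2_eq_square)
      also have "\<dots> = (\<Sum>i\<in>UNIV. h i \<bullet> adjoint_op (X $ i) v)"
        by (subst v_def) (simp add: inner_sum_left inner_adjoint_op[OF X])
      also have "\<dots> \<le> L2_set (\<lambda>i. norm (h i)) UNIV
          * L2_set (\<lambda>i. norm (adjoint_op (X $ i) v)) UNIV"
        by (rule inner_L2_set_le)
      also have "\<dots> \<le> L2_set (\<lambda>i. norm (h i)) UNIV * (s * norm v)"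
        by (intro mult_left_mono adj) simp
      finally have "norm v * norm v \<le> (s * L2_set (\<lambda>i. norm (h i)) UNIV) * norm v"
        by (simp add: mult_ac)
      then show "norm v \<le> s * L2_set (\<lambda>i. norm (h i)) UNIV"
        by (rule mult_self_le_imp_le) (use s in simp_all)
    qed
  next
    assume H: "\<forall>h. norm (\<Sum>i\<in>UNIV. (X $ i) (h i)) \<le> s * L2_set (\<lambda>i. norm (h i)) UNIV"
    show "norm P \<le> s\<^sup>2"
    proof (rule norm_blinfun_bound)
      fix y
      define l where "l = L2_set (\<lambda>i. norm (adjoint_op (X $ i) y)) UNIV"
      have l0: "0 \<le> l" by (simp add: l_def)
      \<comment> \<open>The hypothesis is used for the tuple of the vectors
        \<open>adjoint_op (X $ i) y\<close>.\<close>
      have 1: "norm (P y) \<le> s * l"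
        using H unfolding Py l_def by (rule spec)
      have "l * l \<le> norm (P y) * norm y"
        using L2adj[of y] norm_cauchy_schwarz[of "P y" y] by (simp add: l_def power2_eq_square)
      also have "\<dots> \<le> (s * norm y) * l"
        using mult_right_mono[OF 1, of "norm y"] by (simp add: mult_ac)
      finally have "l \<le> s * norm y"
        by (rule mult_self_le_imp_le) (use s l0 in simp_all)
      with 1 s show "norm (P y) \<le> s\<^sup>2 * norm y"
        using mult_left_mono[of l "s * norm y" s] by (simp add: power2_eq_square mult_ac)
    qed simp
  qed
  finally show ?thesis .
qed

subsection \<open>Orthonormal families\<close>

lemma norm_sum_orthonormal:
  fixes e :: "'i \<Rightarrow> 'a::complex_hilbert"
  assumes "finite A" and e: "\<And>x y. x \<in> A \<Longrightarrow> y \<in> A \<Longrightarrow> cinner (e x) (e y) = (if x = y then 1 else 0)"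
  shows "(norm (\<Sum>x\<in>A. c x *\<^sub>C e x))\<^sup>2 = (\<Sum>x\<in>A. (cmod (c x))\<^sup>2)"
proof -
  have "cinner (\<Sum>x\<in>A. c x *\<^sub>C e x) (\<Sum>x\<in>A. c x *\<^sub>C e x)
      = (\<Sum>x\<in>A. \<Sum>y\<in>A. c x * (cnj (c y) * cinner (e x) (e y)))"
    by (simp add: cinner_sum_left cinner_scaleC_left)
      (simp add: cinner_sum_right cinner_scaleC_right sum_distrib_left)
  also have "\<dots> = (\<Sum>x\<in>A. \<Sum>y\<in>A. if x = y then c x * cnj (c x) else 0)"
    by (intro sum.cong refl) (simp add: e)
  also have "\<dots> = (\<Sum>x\<in>A. c x * cnj (c x))"
    using \<open>finite A\<close> by simp
  also have "\<dots> = complex_of_real (\<Sum>x\<in>A. (cmod (c x))\<^sup>2)"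
    by (simp add: complex_norm_square del: of_real_power)
  finally show ?thesis
    unfolding cinner_self of_real_eq_iff .
qed

lemma Bessel_inequality:
  fixes e :: "'i \<Rightarrow> 'a::complex_hilbert"
  assumes "finite A" and e: "\<And>x y. x \<in> A \<Longrightarrow> y \<in> A \<Longrightarrow> cinner (e x) (e y) = (if x = y then 1 else 0)"
  shows "(\<Sum>x\<in>A. (cmod (cinner v (e x)))\<^sup>2) \<le> (norm v)\<^sup>2"
proof -
  \<comment> \<open>\<open>p\<close> is the orthogonal projection of \<open>v\<close> onto the span
    of the family; the claim comes from expanding the squared norm of \<open>v - p\<close>.\<close>
  define p where "p = (\<Sum>x\<in>A. cinner v (e x) *\<^sub>C e x)"
  have "cinner v p = (\<Sum>x\<in>A. cinner v (e x) * cnj (cinner v (e x)))"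
    by (simp add: p_def cinner_sum_right cinner_scaleC_right mult.commute)
  also have "\<dots> = complex_of_real (\<Sum>x\<in>A. (cmod (cinner v (e x)))\<^sup>2)"
    by (simp add: complex_norm_square del: of_real_power)
  finally have "v \<bullet> p = (\<Sum>x\<in>A. (cmod (cinner v (e x)))\<^sup>2)"
    by (simp add: inner_eq_Re_cinner)
  moreover have "p \<bullet> p = (\<Sum>x\<in>A. (cmod (cinner v (e x)))\<^sup>2)"
    unfolding power2_norm_eq_inner[symmetric] p_def by (rule norm_sum_orthonormal[OF assms])
  moreover have "0 \<le> (v - p) \<bullet> (v - p)"
    by simp
  ultimately show ?thesis
    unfolding power2_norm_eq_inner
    by (simp add: inner_diff_left inner_diff_right inner_commute[of p v])
qed

text \<open>One Gram-Schmidt step per index: the finitely many vectors found so far never span the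
  space, so some vector outside their span can be orthogonalized and normalized.\<close>

lemma orthonormal_family_exists:
  assumes inf: "\<not> (\<exists>B::'h::complex_hilbert set. finite B \<and> complex_vector.span B = UNIV)"
    and "finite A"
  shows "\<exists>e :: 'i \<Rightarrow> 'h. \<forall>x\<in>A. \<forall>y\<in>A. cinner (e x) (e y) = (if x = y then 1 else 0)"
  using \<open>finite A\<close>
proof (induction A rule: finite_induct)
  case empty
  then show ?case by simp
next
  case (insert a A)
  then obtain e :: "'i \<Rightarrow> 'h"
    where e: "\<And>x y. x \<in> A \<Longrightarrow> y \<in> A \<Longrightarrow> cinner (e x) (e y) = (if x = y then 1 else 0)"
    by blast
  obtain v where v: "v \<notin> complex_vector.span (e ` A)"
    using inf insert.hyps(1) by blast
  define w where "w = v - (\<Sum>x\<in>A. cinner v (e x) *\<^sub>C e x)"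
  have "(\<Sum>x\<in>A. cinner v (e x) *\<^sub>C e x) \<in> complex_vector.span (e ` A)"
    by (intro complex_vector.span_sum complex_vector.span_scale complex_vector.span_base imageI)
  with v have "w \<noteq> 0"
    by (auto simp: w_def)
  have we: "cinner w (e y) = 0" if "y \<in> A" for y
  proof -
    have "cinner w (e y) = cinner v (e y) - (\<Sum>x\<in>A. if x = y then cinner v (e y) else 0)"
      unfolding w_def cinner_diff_left cinner_sum_left cinner_scaleC_left
      by (intro arg_cong2[where f = "(-)"] sum.cong refl) (simp add: e that)
    then show ?thesis
      using insert.hyps(1) that by simp
  qed
  then have ew: "cinner (e y) w = 0" if "y \<in> A" for y
    using that by (metis cinner_commute complex_cnj_zero)
  define u where "u = complex_of_real (inverse (norm w)) *\<^sub>C w"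
  have "norm u = 1"
    using \<open>w \<noteq> 0\<close> by (simp add: u_def norm_scaleC norm_inverse)
  then have "cinner u u = 1"
    by (simp add: cinner_self)
  moreover have "cinner u (e y) = 0" "cinner (e y) u = 0" if "y \<in> A" for y
    using that by (simp_all add: u_def cinner_scaleC_left cinner_scaleC_right we ew)
  ultimately have "\<forall>x\<in>insert a A. \<forall>y\<in>insert a A.
      cinner ((e(a := u)) x) ((e(a := u)) y) = (if x = y then 1 else 0)"
    using e insert.hyps(2) by auto
  then show ?case by blast
qed

subsection \<open>Homogeneous parts on row contractions\<close>

lemma finite_words: "finite {\<alpha> :: 'n::finite list. length \<alpha> = k}"
  using finite_lists_length_eq[of "UNIV :: 'n set" k] by simp

lemma finite_words_less: "finite {\<alpha> :: 'n::finite list. length \<alpha> < k}"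
  by (rule finite_subset[OF _ finite_lists_length_le[of "UNIV :: 'n set" k]]) auto

text \<open>Recursion on word length through the first letter, on which the inductions below
  rest.\<close>

lemma sum_words_Suc:
  "(\<Sum>\<alpha> :: 'n::finite list | length \<alpha> = Suc k. f \<alpha>)
    = (\<Sum>i\<in>UNIV. \<Sum>\<beta> | length \<beta> = k. f (i # \<beta>))"
proof -
  have "(\<Sum>\<alpha> :: 'n list | length \<alpha> = Suc k. f \<alpha>)
      = (\<Sum>(i, \<beta>)\<in>UNIV \<times> {\<beta>. length \<beta> = k}. f (i # \<beta>))"
    by (rule sum.reindex_bij_witness[where i = "\<lambda>(i, \<beta>). i # \<beta>" and j = "\<lambda>\<alpha>. (hd \<alpha>, tl \<alpha>)"])
      (auto simp: length_Suc_conv)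
  then show ?thesis
    by (simp add: sum.cartesian_product)
qed

text \<open>This is \<open>N\<^sub>k a\<close> of the opening comment, a seminorm in
  \<open>a\<close> for each fixed \<open>k\<close>.\<close>

definition word_norm :: "'n::finite ncseries \<Rightarrow> nat \<Rightarrow> real" where
  "word_norm a k = L2_set (\<lambda>\<alpha>. cmod (a \<alpha>)) {\<alpha>. length \<alpha> = k}"

lemma word_norm_nonneg [simp]: "0 \<le> word_norm a k"
  by (simp add: word_norm_def)

lemma L2_set_words_Suc:
  "L2_set f {\<alpha> :: 'n::finite list. length \<alpha> = Suc k}
    = L2_set (\<lambda>i. L2_set (\<lambda>\<beta>. f (i # \<beta>)) {\<beta>. length \<beta> = k}) UNIV"
  by (simp add: L2_set_def sum_words_Suc sum_nonneg)

section \<open>The closed algebra of complex-linear operators\<close>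

lemma bounded_ops_zero: "0 \<in> bounded_ops"
  by (simp add: bounded_ops_def)

lemma bounded_ops_id: "id_blinfun \<in> bounded_ops"
  by (simp add: bounded_ops_def)

lemma bounded_ops_add: "S \<in> bounded_ops \<Longrightarrow> T \<in> bounded_ops \<Longrightarrow> S + T \<in> bounded_ops"
  by (simp add: bounded_ops_def blinfun.add_left scaleC_add_right)

lemma bounded_ops_compose: "S \<in> bounded_ops \<Longrightarrow> T \<in> bounded_ops \<Longrightarrow> S o\<^sub>L T \<in> bounded_ops"
  by (simp add: bounded_ops_def)

lemma scaleC_op_apply [simp]: "blinfun_apply (scaleC_op c T) x = c *\<^sub>C blinfun_apply T x"
  by transfer simp

lemma bounded_ops_scaleC_op: "T \<in> bounded_ops \<Longrightarrow> scaleC_op c T \<in> bounded_ops"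
  by (simp add: bounded_ops_def scaleC_scaleC mult.commute)

lemma bounded_ops_sum: "(\<And>i. i \<in> A \<Longrightarrow> f i \<in> bounded_ops) \<Longrightarrow> sum f A \<in> bounded_ops"
  by (induction A rule: infinite_finite_induct) (simp_all add: bounded_ops_zero bounded_ops_add)

text \<open>Each condition on \<open>c\<close> and \<open>x\<close> is an equation between
  continuous functions of \<open>T\<close>. Sums of convergent series therefore remain complex
  linear.\<close>

lemma closed_bounded_ops: "closed (bounded_ops :: ('h::complex_hilbert \<Rightarrow>\<^sub>L 'h) set)"
proof -
  have "continuous_on UNIV (\<lambda>T :: 'h \<Rightarrow>\<^sub>L 'h. c *\<^sub>C blinfun_apply T x)" for c x
    by (rule bounded_linear.continuous_on[OF bounded_linear_scaleC]) (intro continuous_intros)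
  then show ?thesis
    unfolding bounded_ops_def
    by (intro closed_Collect_all closed_Collect_eq) (intro continuous_intros)
qed

lemma bounded_ops_word_op:
  "(\<And>i. X $ i \<in> bounded_ops) \<Longrightarrow> word_op X \<alpha> \<in> bounded_ops"
  by (induction \<alpha>) (simp_all add: bounded_ops_id bounded_ops_compose)

lemma bounded_ops_hom_part:
  "(\<And>i. X $ i \<in> bounded_ops) \<Longrightarrow> hom_part a k X \<in> bounded_ops"
  unfolding hom_part_def by (intro bounded_ops_sum bounded_ops_scaleC_op bounded_ops_word_op)

lemma bounded_ops_sums:
  assumes "\<And>i. X $ i \<in> bounded_ops" and "(\<lambda>k. hom_part a k X) sums T"
  shows "T \<in> bounded_ops"
  using assms(2) unfolding sums_def
  by (rule closed_sequentially[OF closed_bounded_ops, rotated])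
    (intro bounded_ops_sum bounded_ops_hom_part assms(1))

section \<open>Operator balls and norms of homogeneous parts\<close>

lemma row_norm_nonneg [simp]: "0 \<le> row_norm X"
  by (simp add: row_norm_def)

lemma op_cballD:
  assumes "X \<in> op_cball s"
  shows "X $ i \<in> bounded_ops" and "0 \<le> s"
    and "norm (\<Sum>i\<in>UNIV. (X $ i) (h i)) \<le> s * L2_set (\<lambda>i. norm (h i)) UNIV"
proof -
  show X: "X $ i \<in> bounded_ops" for i
    using assms by (simp add: op_cball_def)
  have le: "row_norm X \<le> s"
    using assms by (simp add: op_cball_def)
  then show s: "0 \<le> s"
    using row_norm_nonneg[of X] by linarith
  show "norm (\<Sum>i\<in>UNIV. (X $ i) (h i)) \<le> s * L2_set (\<lambda>i. norm (h i)) UNIV"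
    using row_norm_le_iff[OF X s] le by blast
qed

text \<open>Ensures that suprema over closed balls are taken over nonempty sets.\<close>

lemma zero_in_op_cball: "0 \<le> s \<Longrightarrow> 0 \<in> op_cball s"
  unfolding op_cball_def using row_norm_le_iff[of 0 s] by (simp add: bounded_ops_zero)

lemma op_cball_subset_op_ball: "s < 1 \<Longrightarrow> op_cball s \<subseteq> op_ball"
  by (auto simp: op_cball_def op_ball_def)

lemma op_cball_mono: "s \<le> t \<Longrightarrow> op_cball s \<subseteq> op_cball t"
  by (auto simp: op_cball_def)

text \<open>The first letter is peeled off: the row of words of length \<open>Suc k\<close> is the
  row \<open>X\<close> applied after the rows of words of length \<open>k\<close>, and each level
  costs a factor \<open>s\<close>. The tuple \<open>h\<close> is generalized because the inner
  tuples \<open>h (i # \<beta>)\<close> vary with \<open>i\<close>.\<close>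

lemma norm_sum_word_op_le:
  assumes X: "X \<in> op_cball s"
  shows "norm (\<Sum>\<alpha> | length \<alpha> = k. word_op X \<alpha> (h \<alpha>))
    \<le> s ^ k * L2_set (\<lambda>\<alpha>. norm (h \<alpha>)) {\<alpha> :: 'n::finite list. length \<alpha> = k}"
proof (induction k arbitrary: h)
  case 0
  then show ?case by simp
next
  case (Suc k)
  have s: "0 \<le> s" using op_cballD(2)[OF X] .
  have "(\<Sum>\<alpha> | length \<alpha> = Suc k. word_op X \<alpha> (h \<alpha>))
      = (\<Sum>i\<in>UNIV. (X $ i) (\<Sum>\<beta> | length \<beta> = k. word_op X \<beta> (h (i # \<beta>))))"
    by (simp add: sum_words_Suc blinfun.sum_right)
  also have "norm \<dots> \<le> s * L2_set (\<lambda>i. norm (\<Sum>\<beta> | length \<beta> = k. word_op X \<beta> (h (i # \<beta>)))) UNIV"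
    by (rule op_cballD(3)[OF X])
  also have "\<dots> \<le> s * L2_set (\<lambda>i. s ^ k * L2_set (\<lambda>\<beta>. norm (h (i # \<beta>))) {\<beta>. length \<beta> = k}) UNIV"
    by (intro mult_left_mono L2_set_mono Suc.IH s) simp
  finally show ?case
    using s by (simp add: L2_set_words_Suc L2_set_right_distrib[symmetric] mult_ac)
qed

lemma hom_part_apply:
  "blinfun_apply (hom_part a k X) v = (\<Sum>\<alpha> | length \<alpha> = k. a \<alpha> *\<^sub>C word_op X \<alpha> v)"
  by (simp add: hom_part_def blinfun.sum_left)

lemma norm_hom_part_le:
  assumes X: "X \<in> op_cball s"
  shows "norm (hom_part a k X) \<le> s ^ k * word_norm a k"
proof (rule norm_blinfun_bound)
  have s: "0 \<le> s" using op_cballD(2)[OF X] .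
  then show "0 \<le> s ^ k * word_norm a k" by simp
  fix v
  \<comment> \<open>Complex linearity moves the scalars inside, so that the row of words acts on the
    tuple \<open>a \<alpha> *\<^sub>C v\<close>.\<close>
  have "norm (hom_part a k X v) = norm (\<Sum>\<alpha> | length \<alpha> = k. word_op X \<alpha> (a \<alpha> *\<^sub>C v))"
    by (simp add: hom_part_apply bounded_ops_scaleC bounded_ops_word_op op_cballD(1)[OF X])
  also have "\<dots> \<le> s ^ k * L2_set (\<lambda>\<alpha>. norm (a \<alpha> *\<^sub>C v)) {\<alpha>. length \<alpha> = k}"
    by (rule norm_sum_word_op_le[OF X])
  finally show "norm (hom_part a k X v) \<le> s ^ k * word_norm a k * norm v"
    by (simp add: norm_scaleC word_norm_def L2_set_left_distrib[symmetric] mult.assoc)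
qed

lemma hom_part_diff:
  "hom_part (\<lambda>\<alpha>. a \<alpha> - b \<alpha>) k X = hom_part a k X - hom_part b k X"
  by (rule blinfun_eqI)
    (simp add: hom_part_apply blinfun.diff_left complex_vector.scale_left_diff_distrib sum_subtractf)

text \<open>Comparison with the geometric series of ratio \<open>s / t\<close>, whose sum
  \<open>t / (t - s)\<close> is the price of shrinking the radius from \<open>t\<close> to
  \<open>s\<close>.\<close>

lemma summable_hom_part:
  assumes X: "X \<in> op_cball s" and t: "s < t" and bd: "\<And>k. t ^ k * word_norm a k \<le> C"
  shows "summable (\<lambda>k. hom_part a k X)" and "norm (\<Sum>k. hom_part a k X) \<le> C * (t / (t - s))"
proof -
  have s: "0 \<le> s" using op_cballD(2)[OF X] .
  have st: "norm (s / t) < 1" "0 \<le> s / t" using s t by simp_all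
  have le: "norm (hom_part a k X) \<le> C * (s / t) ^ k" for k
  proof -
    have "norm (hom_part a k X) \<le> s ^ k * word_norm a k"
      by (rule norm_hom_part_le[OF X])
    also have "\<dots> = (s / t) ^ k * (t ^ k * word_norm a k)"
      using s t by (simp add: power_divide)
    also have "\<dots> \<le> (s / t) ^ k * C"
      using st(2) by (intro mult_left_mono bd) simp
    finally show ?thesis by (simp add: mult.commute)
  qed
  have geo: "(\<lambda>k. C * (s / t) ^ k) sums (C * (1 / (1 - s / t)))"
    by (intro sums_mult geometric_sums st)
  have sn: "summable (\<lambda>k. norm (hom_part a k X))"
    by (rule summable_comparison_test[OF _ sums_summable[OF geo]]) (use le in auto)
  then show "summable (\<lambda>k. hom_part a k X)"
    by (rule summable_norm_cancel)
  have "norm (\<Sum>k. hom_part a k X) \<le> (\<Sum>k. norm (hom_part a k X))"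
    by (rule summable_norm[OF sn])
  also have "\<dots> \<le> C * (1 / (1 - s / t))"
    using suminf_le[OF le sn sums_summable[OF geo]] sums_unique[OF geo] by simp
  also have "1 / (1 - s / t) = t / (t - s)"
    using s t by (simp add: field_simps)
  finally show "norm (\<Sum>k. hom_part a k X) \<le> C * (t / (t - s))" .
qed

subsection \<open>Cauchy estimates from truncated creation operators\<close>

text \<open>For an orthonormal family these are the left creation operators of the full Fock space,
  scaled by \<open>t\<close> and compressed to words of length at most \<open>k\<close>. The cutoff
  means that finitely many orthonormal vectors suffice.\<close>

definition truncated_creation ::
  "('n::finite list \<Rightarrow> 'h::complex_hilbert) \<Rightarrow> real \<Rightarrow> nat \<Rightarrow> ('h \<Rightarrow>\<^sub>L 'h) ^ 'n" where
  "truncated_creation e t k = (\<chi> i. Blinfun (\<lambda>h. \<Sum>\<alpha> | length \<alpha> < k.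
    (complex_of_real t * cinner h (e \<alpha>)) *\<^sub>C e (i # \<alpha>)))"

lemma truncated_creation_apply:
  "blinfun_apply (truncated_creation e t k $ i) h =
    (\<Sum>\<alpha> | length \<alpha> < k. (complex_of_real t * cinner h (e \<alpha>)) *\<^sub>C e (i # \<alpha>))"
proof -
  have "bounded_linear (\<lambda>h. (complex_of_real t * cinner h (e \<alpha>)) *\<^sub>C e (i # \<alpha>))" for \<alpha>
  proof (rule bounded_linear_intro[where K = "\<bar>t\<bar> * norm (e \<alpha>) * norm (e (i # \<alpha>))"])
    fix x
    show "norm ((complex_of_real t * cinner x (e \<alpha>)) *\<^sub>C e (i # \<alpha>))
        \<le> norm x * (\<bar>t\<bar> * norm (e \<alpha>) * norm (e (i # \<alpha>)))"
      using mult_left_mono[OF norm_cinner_le[of x "e \<alpha>"], of "\<bar>t\<bar> * norm (e (i # \<alpha>))"]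
      by (simp add: norm_scaleC norm_mult mult_ac)
  qed (simp_all add: cinner_add_left scaleC_add_left scaleR_scaleC cinner_scaleC_left
      scaleC_scaleC distrib_left mult_ac)
  then have "bounded_linear (\<lambda>h. \<Sum>\<alpha> | length \<alpha> < k.
      (complex_of_real t * cinner h (e \<alpha>)) *\<^sub>C e (i # \<alpha>))"
    by (intro bounded_linear_sum)
  then show ?thesis
    by (simp add: truncated_creation_def bounded_linear_Blinfun_apply)
qed

context
  fixes e :: "'n::finite list \<Rightarrow> 'h::complex_hilbert" and t :: real and k :: nat
  assumes e: "\<And>\<alpha> \<beta>. length \<alpha> \<le> k \<Longrightarrow> length \<beta> \<le> k \<Longrightarrow>
      cinner (e \<alpha>) (e \<beta>) = (if \<alpha> = \<beta> then 1 else 0)"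
    and t: "0 \<le> t"
begin

text \<open>Distinct pairs of a letter and a word give distinct words \<open>i # \<alpha>\<close>,
  so the output expands in an orthonormal family. Its coordinates are those of the vectors
  \<open>h i\<close> scaled by \<open>t\<close>, which Bessel's inequality bounds.\<close>

lemma truncated_creation_in_op_cball: "truncated_creation e t k \<in> op_cball t"
proof -
  let ?X = "truncated_creation e t k"
  let ?W = "{\<alpha> :: 'n list. length \<alpha> < k}"
  have bdd: "?X $ i \<in> bounded_ops" for i
    by (simp add: bounded_ops_def truncated_creation_apply cinner_scaleC_left
        complex_vector.scale_sum_right scaleC_scaleC mult_ac)
  have "norm (\<Sum>i\<in>UNIV. (?X $ i) (h i)) \<le> t * L2_set (\<lambda>i. norm (h i)) UNIV" for h
  proof (rule power2_le_imp_le)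
    have "(norm (\<Sum>i\<in>UNIV. (?X $ i) (h i)))\<^sup>2 = (norm (\<Sum>p\<in>UNIV \<times> ?W.
        (complex_of_real t * cinner (h (fst p)) (e (snd p))) *\<^sub>C e (fst p # snd p)))\<^sup>2"
      by (simp add: truncated_creation_apply sum.cartesian_product case_prod_unfold)
    also have "\<dots> = (\<Sum>p\<in>UNIV \<times> ?W. (cmod (complex_of_real t * cinner (h (fst p)) (e (snd p))))\<^sup>2)"
      by (rule norm_sum_orthonormal) (auto simp: finite_words_less e split: if_splits)
    also have "\<dots> = t\<^sup>2 * (\<Sum>i\<in>UNIV. \<Sum>\<alpha>\<in>?W. (cmod (cinner (h i) (e \<alpha>)))\<^sup>2)"
      by (simp add: norm_mult power_mult_distrib sum.cartesian_product case_prod_unfold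
          sum_distrib_left)
    also have "\<dots> \<le> t\<^sup>2 * (\<Sum>i\<in>UNIV. (norm (h i))\<^sup>2)"
      by (intro mult_left_mono sum_mono Bessel_inequality) (auto simp: finite_words_less e)
    finally show "(norm (\<Sum>i\<in>UNIV. (?X $ i) (h i)))\<^sup>2 \<le> (t * L2_set (\<lambda>i. norm (h i)) UNIV)\<^sup>2"
      by (simp add: power_mult_distrib L2_set_def sum_nonneg)
  qed (use t in simp)
  then show ?thesis
    using row_norm_le_iff[OF bdd t] bdd by (simp add: op_cball_def)
qed

lemma word_op_truncated_creation:
  "blinfun_apply (word_op (truncated_creation e t k) \<alpha>) (e []) =
    (if length \<alpha> \<le> k then complex_of_real (t ^ length \<alpha>) *\<^sub>C e \<alpha> else 0)"
proof (induction \<alpha>)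
  case Nil
  then show ?case by (simp add: scaleC_one)
next
  case (Cons i \<alpha>)
  show ?case
  proof (cases "length \<alpha> \<le> k")
    case True
    have "blinfun_apply (word_op (truncated_creation e t k) (i # \<alpha>)) (e []) =
        (\<Sum>\<beta> | length \<beta> < k. (complex_of_real t * (complex_of_real (t ^ length \<alpha>)
          * cinner (e \<alpha>) (e \<beta>))) *\<^sub>C e (i # \<beta>))"
      using True by (simp add: Cons.IH truncated_creation_apply cinner_scaleC_left)
    also have "\<dots> = (\<Sum>\<beta> | length \<beta> < k.
        if \<beta> = \<alpha> then complex_of_real (t ^ length (i # \<alpha>)) *\<^sub>C e (i # \<alpha>) else 0)"
      using True by (intro sum.cong refl) (auto simp: e)
    \<comment> \<open>The summation range contains \<open>\<alpha>\<close> exactly if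
      \<open>Suc (length \<alpha>) \<le> k\<close>; for \<open>length \<alpha> = k\<close> the sum
      is zero, as the truncation demands.\<close>
    also have "\<dots> = (if length (i # \<alpha>) \<le> k
        then complex_of_real (t ^ length (i # \<alpha>)) *\<^sub>C e (i # \<alpha>) else 0)"
      using finite_words_less[where 'n = 'n, of k] by (simp add: Suc_le_eq)
    finally show ?thesis .
  qed (simp add: Cons.IH blinfun.zero_right)
qed

text \<open>A word maps \<open>e []\<close> to zero or to a multiple of the vector of that word, so
  a coordinate at level \<open>k\<close> sees the homogeneous part of degree \<open>k\<close>
  alone.\<close>

lemma cinner_hom_part_truncated_creation:
  assumes "length \<beta> = k"
  shows "cinner (blinfun_apply (hom_part a j (truncated_creation e t k)) (e [])) (e \<beta>) =
    (if j = k then a \<beta> * complex_of_real (t ^ k) else 0)"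
proof -
  have "cinner (blinfun_apply (hom_part a j (truncated_creation e t k)) (e [])) (e \<beta>) =
      (\<Sum>\<alpha> | length \<alpha> = j. if \<alpha> = \<beta> then a \<beta> * complex_of_real (t ^ k) else 0)"
    unfolding hom_part_apply cinner_sum_left cinner_scaleC_left
    by (intro sum.cong refl)
      (use assms in \<open>auto simp: word_op_truncated_creation e cinner_scaleC_left\<close>)
  then show ?thesis
    using finite_words[where 'n = 'n, of j] assms by auto
qed

end

text \<open>The Cauchy estimate, obtained by testing on truncated creation operators. No radius is
  lost here, in contrast to \<open>summable_hom_part\<close>.\<close>

lemma word_norm_le_of_bounded:
  fixes f :: "('h::complex_hilbert, 'n::finite) op_fun"
  assumes inf: "\<not> (\<exists>B::'h set. finite B \<and> complex_vector.span B = UNIV)"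
    and t: "0 \<le> t"
    and sums: "\<And>X. X \<in> op_cball t \<Longrightarrow> (\<lambda>k. hom_part a k X) sums f X"
    and C: "\<And>X. X \<in> op_cball t \<Longrightarrow> norm (f X) \<le> C"
  shows "t ^ k * word_norm a k \<le> C"
proof -
  obtain e :: "'n list \<Rightarrow> 'h" where e: "\<And>\<alpha> \<beta>. length \<alpha> \<le> k \<Longrightarrow> length \<beta> \<le> k \<Longrightarrow>
      cinner (e \<alpha>) (e \<beta>) = (if \<alpha> = \<beta> then 1 else 0)"
    using orthonormal_family_exists[OF inf finite_words_less[where 'n = 'n, of "Suc k"]]
    by (auto simp: less_Suc_eq_le)
  define X where "X = truncated_creation e t k"
  have X: "X \<in> op_cball t"
    unfolding X_def using e t by (rule truncated_creation_in_op_cball)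
  \<comment> \<open>Coordinate functionals are continuous and can be applied to the series termwise;
    all terms but the \<open>k\<close>-th vanish.\<close>
  have co: "cinner (f X (e [])) (e \<beta>) = a \<beta> * complex_of_real (t ^ k)" if "length \<beta> = k" for \<beta>
  proof -
    have "(\<lambda>j. cinner (hom_part a j X (e [])) (e \<beta>)) sums cinner (f X (e [])) (e \<beta>)"
      using sums[OF X]
      by (intro bounded_linear.sums[OF bounded_linear_cinner_left]
          blinfun.bounded_linear_left[THEN bounded_linear.sums])
    moreover have "(\<lambda>j. cinner (hom_part a j X (e [])) (e \<beta>)) sums (a \<beta> * complex_of_real (t ^ k))"
    proof -
      have "cinner (hom_part a j X (e [])) (e \<beta>) =
          (if j = k then a \<beta> * complex_of_real (t ^ k) else 0)" for j
        unfolding X_def using e t that by (rule cinner_hom_part_truncated_creation)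
      then show ?thesis
        using sums_single[of k "\<lambda>_. a \<beta> * complex_of_real (t ^ k)"] by simp
    qed
    ultimately show ?thesis
      by (rule sums_unique2)
  qed
  have "norm (e []) ^ 2 = 1"
    using e[of "[]" "[]"] by (simp add: cinner_self flip: of_real_power)
  then have e1: "norm (e []) = 1"
    by (simp add: power2_eq_1_iff) (use norm_ge_zero[of "e []"] in linarith)
  have "(t ^ k * word_norm a k)\<^sup>2 = (\<Sum>\<beta> | length \<beta> = k. (cmod (cinner (f X (e [])) (e \<beta>)))\<^sup>2)"
    using t by (simp add: co word_norm_def L2_set_def sum_nonneg power_mult_distrib norm_mult norm_power
        sum_distrib_left mult.commute)
  also have "\<dots> \<le> (norm (f X (e [])))\<^sup>2"
    by (rule Bessel_inequality) (auto simp: finite_words e)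
  also have "\<dots> \<le> (norm (f X))\<^sup>2"
    using norm_blinfun[of "f X" "e []"] by (simp add: e1)
  finally have "t ^ k * word_norm a k \<le> norm (f X)"
    by (rule power2_le_imp_le) simp
  also have "\<dots> \<le> C"
    by (rule C[OF X])
  finally show ?thesis .
qed

subsection \<open>Coefficients of free holomorphic functions\<close>

text \<open>The root test for radius of convergence at least one. The squares match the roots of
  order \<open>2 * k\<close> of sums of squares in \<open>has_free_series\<close>.\<close>

lemma limsup_root_square_le_1_iff:
  fixes A :: "nat \<Rightarrow> real"
  assumes A: "\<And>k. 0 \<le> A k"
  shows "limsup (\<lambda>k. ereal (root (2 * k) ((A k)\<^sup>2))) \<le> 1
    \<longleftrightarrow> (\<forall>s. 0 < s \<and> s < 1 \<longrightarrow> (\<exists>C. \<forall>k. s ^ k * A k \<le> C))"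
proof (intro iffI allI impI)
  fix s :: real
  assume lim: "limsup (\<lambda>k. ereal (root (2 * k) ((A k)\<^sup>2))) \<le> 1" and s: "0 < s \<and> s < 1"
  then have "limsup (\<lambda>k. ereal (root (2 * k) ((A k)\<^sup>2))) < ereal (1 / s)"
    by (intro le_less_trans[OF lim]) (simp add: one_ereal_def)
  then have "\<forall>\<^sub>F k in sequentially. ereal (root (2 * k) ((A k)\<^sup>2)) < ereal (1 / s)"
    by (rule Limsup_lessD)
  then obtain N where N: "\<And>k. k \<ge> N \<Longrightarrow> root (2 * k) ((A k)\<^sup>2) < 1 / s"
    by (auto simp: eventually_sequentially)
  \<comment> \<open>Starting at \<open>Suc N\<close> keeps \<open>k\<close> positive, so that the
    root of order \<open>2 * k\<close> inverts the power.\<close>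
  have big: "s ^ k * A k \<le> 1" if "k \<ge> Suc N" for k
  proof -
    have k: "0 < 2 * k" using that by simp
    have "(A k)\<^sup>2 = root (2 * k) ((A k)\<^sup>2) ^ (2 * k)"
      by (rule real_root_pow_pos2[OF k, symmetric]) simp
    also have "\<dots> \<le> (1 / s) ^ (2 * k)"
      by (rule power_mono) (use N[of k] that in auto)
    also have "\<dots> = ((1 / s) ^ k)\<^sup>2"
      by (simp add: power_mult mult.commute flip: power_mult)
    finally have "A k \<le> (1 / s) ^ k"
      by (rule power2_le_imp_le) (use s in simp)
    then show ?thesis
      using s by (simp add: field_simps)
  qed
  \<comment> \<open>The finitely many terms with index at most \<open>N\<close> are absorbed by
    their sum.\<close>
  have "s ^ k * A k \<le> 1 + (\<Sum>j\<le>N. s ^ j * A j)" for k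
  proof (cases "k \<le> N")
    case True
    then have "s ^ k * A k \<le> (\<Sum>j\<le>N. s ^ j * A j)"
      using s A by (intro member_le_sum) auto
    then show ?thesis by simp
  next
    case False
    moreover have "0 \<le> (\<Sum>j\<le>N. s ^ j * A j)"
      using s A by (intro sum_nonneg) simp
    ultimately show ?thesis
      using big[of k] by simp
  qed
  then show "\<exists>C. \<forall>k. s ^ k * A k \<le> C"
    by blast
next
  assume bd: "\<forall>s. 0 < s \<and> s < 1 \<longrightarrow> (\<exists>C. \<forall>k. s ^ k * A k \<le> C)"
  show "limsup (\<lambda>k. ereal (root (2 * k) ((A k)\<^sup>2))) \<le> 1"
  proof (rule dense_ge)
    fix y :: ereal assume "1 < y"
    then obtain c where c: "1 < ereal c" "ereal c < y"
      using ereal_dense2 by blast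
    then have c1: "1 < c" by simp
    \<comment> \<open>Such an \<open>s\<close> has \<open>s * c > 1\<close>, so some power of
      \<open>s * c\<close> exceeds the bound \<open>C\<close>.\<close>
    then obtain s where s: "1 / c < s" "s < 1"
      using dense[of "1 / c" 1] by auto
    then have s0: "0 < s" using c1 by (meson less_trans zero_less_divide_1_iff zero_less_one)
    have sc: "1 < s * c" using s(1) c1 by (simp add: field_simps)
    obtain C where C: "\<And>k. s ^ k * A k \<le> C"
      using bd s(2) s0 by blast
    obtain N where N: "C < (s * c) ^ N"
      using real_arch_pow[OF sc] by blast
    have "root (2 * k) ((A k)\<^sup>2) \<le> c" if "k \<ge> Suc N" for k
    proof -
      have "s ^ k * A k \<le> (s * c) ^ N"
        using C[of k] N by simp
      also have "\<dots> \<le> (s * c) ^ k"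
        by (rule power_increasing) (use that sc in simp_all)
      finally have "A k \<le> c ^ k"
        using s0 by (simp add: power_mult_distrib)
      then have "(A k)\<^sup>2 \<le> (c ^ k)\<^sup>2"
        by (rule power_mono[OF _ A])
      then have "(A k)\<^sup>2 \<le> c ^ (2 * k)"
        by (simp add: power_mult mult.commute flip: power_mult)
      then have "root (2 * k) ((A k)\<^sup>2) \<le> root (2 * k) (c ^ (2 * k))"
        using that by simp
      then show ?thesis
        using that c1 by (simp add: real_root_power_cancel)
    qed
    then have "\<forall>\<^sub>F k in sequentially. ereal (root (2 * k) ((A k)\<^sup>2)) \<le> y"
      unfolding eventually_sequentially using c(2) by (meson ereal_less_eq(3) le_less_trans less_imp_le)
    then show "limsup (\<lambda>k. ereal (root (2 * k) ((A k)\<^sup>2))) \<le> y"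
      by (rule Limsup_bounded)
  qed
qed

text \<open>By \<open>limsup_root_square_le_1_iff\<close> this is the limsup condition of
  \<open>has_free_series\<close>, in the form of finite weighted suprema.\<close>

definition ball_coeffs :: "'n::finite ncseries \<Rightarrow> bool" where
  "ball_coeffs a \<longleftrightarrow> (\<forall>s. 0 < s \<and> s < 1 \<longrightarrow> (\<exists>C. \<forall>k. s ^ k * word_norm a k \<le> C))"

lemma has_free_series_iff:
  "has_free_series f a \<longleftrightarrow> ball_coeffs a \<and> (\<forall>X\<in>op_ball. (\<lambda>k. hom_part a k X) sums f X)"
proof -
  have "(\<Sum>\<alpha> | length \<alpha> = k. (cmod (a \<alpha>))\<^sup>2) = (word_norm a k)\<^sup>2" for k
    by (simp add: word_norm_def L2_set_def sum_nonneg)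
  then show ?thesis
    unfolding has_free_series_def ball_coeffs_def
    by (simp add: limsup_root_square_le_1_iff)
qed

section \<open>Coefficient norms and the functions defined by series\<close>

lemma word_norm_add: "word_norm (\<lambda>\<alpha>. a \<alpha> + b \<alpha>) k \<le> word_norm a k + word_norm b k"
  unfolding word_norm_def
  by (rule order_trans[OF L2_set_mono L2_set_triangle_ineq]) (simp_all add: norm_triangle_ineq)

lemma word_norm_diff: "word_norm (\<lambda>\<alpha>. a \<alpha> - b \<alpha>) k \<le> word_norm a k + word_norm b k"
  using word_norm_add[of a "\<lambda>\<alpha>. - b \<alpha>" k] by (simp add: word_norm_def)

lemma norm_coeff_le_word_norm: "cmod (a \<alpha>) \<le> word_norm a (length \<alpha>)"
  unfolding word_norm_def by (rule member_le_L2_set) (simp_all add: finite_words)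

lemma word_norm_Suc: "word_norm a (Suc k) = L2_set (\<lambda>i. word_norm (\<lambda>\<beta>. a (i # \<beta>)) k) UNIV"
  by (simp add: word_norm_def L2_set_words_Suc)

lemma tendsto_word_norm:
  "(\<And>\<alpha>. (\<lambda>j. a j \<alpha>) \<longlonglongrightarrow> b \<alpha>) \<Longrightarrow> (\<lambda>j. word_norm (a j) k) \<longlonglongrightarrow> word_norm b k"
  unfolding word_norm_def L2_set_def by (intro tendsto_intros)

lemma ball_coeffs_diff:
  assumes "ball_coeffs a" "ball_coeffs b"
  shows "ball_coeffs (\<lambda>\<alpha>. a \<alpha> - b \<alpha>)"
  unfolding ball_coeffs_def
proof (intro allI impI)
  fix s :: real assume s: "0 < s \<and> s < 1"
  then obtain C D where C: "\<And>k. s ^ k * word_norm a k \<le> C" and D: "\<And>k. s ^ k * word_norm b k \<le> D"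
    using assms unfolding ball_coeffs_def by meson
  have "s ^ k * word_norm (\<lambda>\<alpha>. a \<alpha> - b \<alpha>) k \<le> C + D" for k
  proof -
    have "s ^ k * word_norm (\<lambda>\<alpha>. a \<alpha> - b \<alpha>) k \<le> s ^ k * (word_norm a k + word_norm b k)"
      using s by (intro mult_left_mono word_norm_diff) simp
    then show ?thesis
      using C[of k] D[of k] by (simp add: distrib_left)
  qed
  then show "\<exists>C. \<forall>k. s ^ k * word_norm (\<lambda>\<alpha>. a \<alpha> - b \<alpha>) k \<le> C"
    by blast
qed

lemma has_free_series_diff:
  "has_free_series f a \<Longrightarrow> has_free_series g b \<Longrightarrow>
    has_free_series (\<lambda>X. f X - g X) (\<lambda>\<alpha>. a \<alpha> - b \<alpha>)"
  unfolding has_free_series_iff by (simp add: ball_coeffs_diff hom_part_diff sums_diff)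

lemma in_op_cball_row_norm: "X \<in> op_ball \<Longrightarrow> X \<in> op_cball (row_norm X)"
  by (simp add: op_ball_def op_cball_def)

lemma has_free_series_bounded:
  assumes f: "has_free_series f a" and s: "s < 1"
  obtains C where "\<And>X. X \<in> op_cball s \<Longrightarrow> norm (f X) \<le> C"
proof -
  \<comment> \<open>A radius strictly between \<open>s\<close> and \<open>1\<close>; the maximum
    keeps it positive when \<open>s\<close> is negative.\<close>
  define t where "t = (1 + max s 0) / 2"
  have t: "0 < t \<and> t < 1" "s < t" using s by (auto simp: t_def)
  then obtain C where C: "\<And>k. t ^ k * word_norm a k \<le> C"
    using f unfolding has_free_series_iff ball_coeffs_def by meson
  have "norm (f X) \<le> C * (t / (t - s))" if "X \<in> op_cball s" for X
  proof -
    have "f X = (\<Sum>k. hom_part a k X)"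
      using f op_cball_subset_op_ball[OF s] that by (auto simp: has_free_series_iff sums_iff)
    then show ?thesis
      using summable_hom_part(2)[OF that t(2) C] by simp
  qed
  then show thesis by (rule that)
qed

text \<open>Serves both for the limit of a Cauchy sequence and for the Hausdorff derivative, each of
  which is found through its coefficients first.\<close>

definition free_function ::
  "'n ncseries \<Rightarrow> ('h::complex_hilbert, 'n::finite) op_fun" where
  "free_function a = (\<lambda>X\<in>op_ball. \<Sum>k. hom_part a k X)"

lemma has_free_series_free_function:
  assumes a: "ball_coeffs a"
  shows "has_free_series (free_function a) a"
  unfolding has_free_series_iff
proof (intro conjI ballI a)
  fix X :: "('b \<Rightarrow>\<^sub>L 'b) ^ 'a" assume X: "X \<in> op_ball"
  \<comment> \<open>A point of the open ball lies in the closed ball of radius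
    \<open>row_norm X\<close>, which leaves room for a radius \<open>t\<close> below
    \<open>1\<close>.\<close>
  define t where "t = (1 + row_norm X) / 2"
  have t: "0 < t \<and> t < 1" "row_norm X < t"
    using X row_norm_nonneg[of X] by (auto simp: t_def op_ball_def simp del: row_norm_nonneg)
  then obtain C where C: "\<And>k. t ^ k * word_norm a k \<le> C"
    using a unfolding ball_coeffs_def by meson
  show "(\<lambda>k. hom_part a k X) sums free_function a X"
    using summable_hom_part(1)[OF in_op_cball_row_norm[OF X] t(2) C] X
    by (simp add: free_function_def summable_sums)
qed

lemma free_function_in_Hol:
  assumes a: "ball_coeffs a"
  shows "free_function a \<in> Hol"
proof -
  have "free_function a X \<in> bounded_ops" if X: "X \<in> op_ball" for X
  proof (rule bounded_ops_sums)
    show "X $ i \<in> bounded_ops" for i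
      using X by (simp add: op_ball_def)
    show "(\<lambda>k. hom_part a k X) sums free_function a X"
      using has_free_series_free_function[OF a] X unfolding has_free_series_iff by blast
  qed
  moreover have "free_function a X = undefined" if "X \<notin> op_ball" for X
    using that by (simp add: free_function_def)
  ultimately show ?thesis
    unfolding Hol_def using has_free_series_free_function[OF a] by auto
qed

subsection \<open>The supremum seminorms\<close>

lemma Hol_free_series:
  assumes "f \<in> Hol"
  obtains a where "has_free_series f a"
  using assms by (auto simp: Hol_def)

lemma rho_at_commute: "rho_at s f g = rho_at s g f"
  by (simp add: rho_at_def norm_minus_commute)

context
  fixes s :: real
  assumes s: "0 \<le> s" "s < 1"
begin

text \<open>Makes the real supremum in \<open>rho_at\<close> a genuine upper bound: the difference
  again has a free series and so is bounded on smaller closed balls.\<close>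

lemma rho_at_bdd_above:
  assumes "f \<in> Hol" "g \<in> Hol"
  shows "bdd_above ((\<lambda>X. norm (f X - g X)) ` op_cball s)"
proof -
  obtain a b where "has_free_series f a" "has_free_series g b"
    using assms by (meson Hol_free_series)
  from has_free_series_bounded[OF has_free_series_diff[OF this] s(2)] show ?thesis
    by (metis (no_types, lifting) bdd_aboveI2)
qed

lemma norm_diff_le_rho_at:
  "f \<in> Hol \<Longrightarrow> g \<in> Hol \<Longrightarrow> X \<in> op_cball s \<Longrightarrow> norm (f X - g X) \<le> rho_at s f g"
  unfolding rho_at_def by (rule cSUP_upper[OF _ rho_at_bdd_above])

lemma rho_at_le:
  "(\<And>X. X \<in> op_cball s \<Longrightarrow> norm (f X - g X) \<le> C) \<Longrightarrow> rho_at s f g \<le> C"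
  unfolding rho_at_def by (rule cSUP_least) (use zero_in_op_cball[OF s(1)] in auto)

lemma rho_at_nonneg: "f \<in> Hol \<Longrightarrow> g \<in> Hol \<Longrightarrow> 0 \<le> rho_at s f g"
  using norm_diff_le_rho_at[OF _ _ zero_in_op_cball[OF s(1)]] norm_ge_zero order_trans by blast

lemma rho_at_triangle:
  fixes f g h :: "('h::complex_hilbert, 'n::finite) op_fun"
  assumes "f \<in> Hol" "g \<in> Hol" "h \<in> Hol"
  shows "rho_at s f h \<le> rho_at s f g + rho_at s g h"
proof (rule rho_at_le)
  fix X :: "('h \<Rightarrow>\<^sub>L 'h) ^ 'n" assume X: "X \<in> op_cball s"
  have "norm (f X - h X) \<le> norm (f X - g X) + norm (g X - h X)"
    by (rule norm_diff_triangle_le[OF order_refl order_refl])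
  also have "\<dots> \<le> rho_at s f g + rho_at s g h"
    by (intro add_mono norm_diff_le_rho_at assms X)
  finally show "norm (f X - h X) \<le> rho_at s f g + rho_at s g h" .
qed

text \<open>One half of the comparison of seminorms: the Cauchy estimate applied to the difference
  of the functions.\<close>

lemma word_norm_le_rho_at:
  fixes f g :: "('h::complex_hilbert, 'n::finite) op_fun"
  assumes inf: "\<not> (\<exists>B::'h set. finite B \<and> complex_vector.span B = UNIV)"
    and "f \<in> Hol" "g \<in> Hol" "has_free_series f a" "has_free_series g b"
  shows "s ^ k * word_norm (\<lambda>\<alpha>. a \<alpha> - b \<alpha>) k \<le> rho_at s f g"
proof (rule word_norm_le_of_bounded[OF inf s(1)])
  fix X :: "('h \<Rightarrow>\<^sub>L 'h) ^ 'n" assume X: "X \<in> op_cball s"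
  then show "(\<lambda>k. hom_part (\<lambda>\<alpha>. a \<alpha> - b \<alpha>) k X) sums (f X - g X)"
    using has_free_series_diff[OF assms(4,5)] op_cball_subset_op_ball[OF s(2)]
    unfolding has_free_series_iff by blast
  show "norm (f X - g X) \<le> rho_at s f g"
    by (rule norm_diff_le_rho_at[OF assms(2,3) X])
qed

text \<open>The other half, by summing the series of the difference; the coefficient bound is taken
  at a larger radius \<open>t\<close>.\<close>

lemma rho_at_le_word_norm:
  fixes f g :: "('h::complex_hilbert, 'n::finite) op_fun"
  assumes "has_free_series f a" "has_free_series g b" and t: "s < t"
    and C: "\<And>k. t ^ k * word_norm (\<lambda>\<alpha>. a \<alpha> - b \<alpha>) k \<le> C"
  shows "rho_at s f g \<le> C * (t / (t - s))"
proof (rule rho_at_le)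
  fix X :: "('h \<Rightarrow>\<^sub>L 'h) ^ 'n" assume X: "X \<in> op_cball s"
  then have "f X - g X = (\<Sum>k. hom_part (\<lambda>\<alpha>. a \<alpha> - b \<alpha>) k X)"
    using has_free_series_diff[OF assms(1,2)] op_cball_subset_op_ball[OF s(2)]
    by (auto simp: has_free_series_iff sums_iff)
  then show "norm (f X - g X) \<le> C * (t / (t - s))"
    using summable_hom_part(2)[OF X t C] by simp
qed

end

lemma rho_at_mono:
  assumes "0 \<le> s" "s \<le> t" "t < 1" "f \<in> Hol" "g \<in> Hol"
  shows "rho_at s f g \<le> rho_at t f g"
  using assms op_cball_mono[OF assms(2)]
  by (intro rho_at_le norm_diff_le_rho_at) auto

text \<open>The difference of two series for \<open>f\<close> represents the zero function, so the
  Cauchy estimate at radius \<open>1/2\<close> annihilates its coefficients.\<close>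

lemma free_coeffs_eq:
  fixes f :: "('h::complex_hilbert, 'n::finite) op_fun"
  assumes inf: "\<not> (\<exists>B::'h set. finite B \<and> complex_vector.span B = UNIV)"
    and a: "has_free_series f a"
  shows "free_coeffs f = a"
  unfolding free_coeffs_def
proof (rule the_equality[where P = "has_free_series f", OF a])
  fix b assume b: "has_free_series f b"
  show "b = a"
  proof
    fix \<alpha> :: "'n list"
    have "(1/2) ^ length \<alpha> * word_norm (\<lambda>\<alpha>. b \<alpha> - a \<alpha>) (length \<alpha>) \<le> 0"
    proof (rule word_norm_le_of_bounded[OF inf])
      fix X :: "('h \<Rightarrow>\<^sub>L 'h) ^ 'n" assume "X \<in> op_cball (1/2)"
      then show "(\<lambda>k. hom_part (\<lambda>\<alpha>. b \<alpha> - a \<alpha>) k X) sums (\<lambda>_. 0) X"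
        using has_free_series_diff[OF b a] op_cball_subset_op_ball[of "1/2"]
        by (auto simp: has_free_series_iff)
    qed simp_all
    moreover have "0 < (1/2 :: real) ^ length \<alpha>"
      by simp
    ultimately have "word_norm (\<lambda>\<alpha>. b \<alpha> - a \<alpha>) (length \<alpha>) \<le> 0"
      unfolding mult_le_0_iff by linarith
    then show "b \<alpha> = a \<alpha>"
      using norm_coeff_le_word_norm[of "\<lambda>\<alpha>. b \<alpha> - a \<alpha>" \<alpha>]
      by (metis eq_iff_diff_eq_0 norm_le_zero_iff order_trans)
  qed
qed

subsection \<open>The metric\<close>

text \<open>The usual combination of countably many seminorms into one metric, on real sequences so
  that its estimates are independent of operators.\<close>

definition frechet_sum :: "(nat \<Rightarrow> real) \<Rightarrow> real" where
  "frechet_sum p = (\<Sum>m. (1 / 2) ^ Suc m * (p m / (1 + p m)))"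

lemma frechet_term_bounds:
  assumes "0 \<le> (p :: real)"
  shows "0 \<le> (1 / 2) ^ Suc m * (p / (1 + p))" "(1 / 2) ^ Suc m * (p / (1 + p)) \<le> (1 / 2) ^ Suc m"
  using assms mult_left_mono[of "p / (1 + p)" 1 "(1 / 2) ^ Suc m"]
  by (simp_all add: divide_le_eq_1 del: power_Suc)

lemma frechet_summable:
  assumes "\<And>m. 0 \<le> p m"
  shows "summable (\<lambda>m. (1 / 2) ^ Suc m * (p m / (1 + p m :: real)))"
proof (rule summable_comparison_test'[OF sums_summable[OF power_half_series]])
  show "norm ((1 / 2) ^ Suc m * (p m / (1 + p m))) \<le> (1 / 2) ^ Suc m" for m
    unfolding real_norm_def abs_of_nonneg[OF frechet_term_bounds(1)[OF assms]]
    by (rule frechet_term_bounds(2)[OF assms])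
qed

lemma frechet_sum_nonneg: "(\<And>m. 0 \<le> p m) \<Longrightarrow> 0 \<le> frechet_sum p"
  unfolding frechet_sum_def
  by (intro suminf_nonneg frechet_summable frechet_term_bounds)

lemma frechet_term_le_sum:
  assumes "\<And>m. 0 \<le> p m"
  shows "(1 / 2) ^ Suc m * (p m / (1 + p m)) \<le> frechet_sum p"
  using sum_le_suminf[OF frechet_summable, of p "{m}"] frechet_term_bounds(1)[OF assms] assms
  by (simp add: frechet_sum_def del: power_Suc)

lemma divide_one_plus_mono: "0 \<le> x \<Longrightarrow> x \<le> y \<Longrightarrow> x / (1 + x) \<le> y / (1 + y :: real)"
  by (simp add: field_simps)

text \<open>Since \<open>x / (1 + x)\<close> is increasing, a single term with
  \<open>p m \<ge> \<epsilon>\<close> would already reach the threshold.\<close>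

lemma frechet_sum_less_imp:
  assumes p: "\<And>m. 0 \<le> p m" and \<epsilon>: "0 < \<epsilon>"
    and less: "frechet_sum p < (1 / 2) ^ Suc m * (\<epsilon> / (1 + \<epsilon>))"
  shows "p m < \<epsilon>"
proof (rule ccontr)
  assume "\<not> p m < \<epsilon>"
  then have "\<epsilon> / (1 + \<epsilon>) \<le> p m / (1 + p m)"
    using \<epsilon> by (intro divide_one_plus_mono) simp_all
  then have "(1 / 2) ^ Suc m * (\<epsilon> / (1 + \<epsilon>)) \<le> (1 / 2) ^ Suc m * (p m / (1 + p m))"
    by (intro mult_left_mono) simp_all
  also have "\<dots> \<le> frechet_sum p"
    by (rule frechet_term_le_sum[OF p])
  finally show False using less by simp
qed

text \<open>The function \<open>x / (1 + x)\<close> is increasing and subadditive on nonnegative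
  reals.\<close>

lemma frechet_sum_triangle:
  assumes "\<And>m. 0 \<le> p m" "\<And>m. 0 \<le> q m" "\<And>m. 0 \<le> u m" and le: "\<And>m. u m \<le> p m + q m"
  shows "frechet_sum u \<le> frechet_sum p + frechet_sum q"
proof -
  have "u m / (1 + u m) \<le> p m / (1 + p m) + q m / (1 + q m)" for m
  proof -
    have "u m / (1 + u m) \<le> (p m + q m) / (1 + (p m + q m))"
      by (intro divide_one_plus_mono assms)
    also have "\<dots> = p m / (1 + (p m + q m)) + q m / (1 + (p m + q m))"
      by (rule add_divide_distrib)
    also have "\<dots> \<le> p m / (1 + p m) + q m / (1 + q m)"
      using assms(1,2)[of m] by (intro add_mono divide_left_mono) simp_all
    finally show ?thesis .
  qed
  then have "(1 / 2) ^ Suc m * (u m / (1 + u m))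
      \<le> (1 / 2) ^ Suc m * (p m / (1 + p m)) + (1 / 2) ^ Suc m * (q m / (1 + q m))" for m
    unfolding distrib_left[symmetric] by (intro mult_left_mono) simp_all
  then have "frechet_sum u \<le> (\<Sum>m. (1 / 2) ^ Suc m * (p m / (1 + p m))
      + (1 / 2) ^ Suc m * (q m / (1 + q m)))"
    unfolding frechet_sum_def by (intro suminf_le summable_add frechet_summable assms)
  also have "\<dots> = frechet_sum p + frechet_sum q"
    unfolding frechet_sum_def by (intro suminf_add[symmetric] frechet_summable assms)
  finally show ?thesis .
qed

text \<open>The first \<open>M\<close> terms total at most \<open>\<delta>\<close>, as
  \<open>x / (1 + x) \<le> x\<close> and the weights sum to at most one; the remaining weights sum
  to \<open>(1 / 2) ^ M\<close>.\<close>

lemma frechet_sum_le: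
  assumes p: "\<And>m. 0 \<le> p m" and M: "\<And>m. m < M \<Longrightarrow> p m \<le> \<delta>" and \<delta>: "0 \<le> \<delta>"
  shows "frechet_sum p \<le> \<delta> + (1 / 2) ^ M"
proof -
  have half: "(\<lambda>m. (1 / 2 :: real) ^ Suc m) sums 1"
    by (rule power_half_series)
  have "frechet_sum p = (\<Sum>m. (1 / 2) ^ Suc (m + M) * (p (m + M) / (1 + p (m + M))))
      + (\<Sum>m<M. (1 / 2) ^ Suc m * (p m / (1 + p m)))"
    unfolding frechet_sum_def by (rule suminf_split_initial_segment[OF frechet_summable[OF p]])
  moreover have "(\<Sum>m. (1 / 2) ^ Suc (m + M) * (p (m + M) / (1 + p (m + M)))) \<le> (1 / 2) ^ M"
  proof -
    have sh: "(\<lambda>m. (1 / 2 :: real) ^ M * (1 / 2) ^ Suc m) sums ((1 / 2) ^ M * 1)"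
      by (rule sums_mult[OF half])
    have "(\<Sum>m. (1 / 2) ^ Suc (m + M) * (p (m + M) / (1 + p (m + M))))
        \<le> (\<Sum>m. (1 / 2) ^ M * (1 / 2) ^ Suc m)"
    proof (rule suminf_le)
      show "(1 / 2) ^ Suc (m + M) * (p (m + M) / (1 + p (m + M))) \<le> (1 / 2) ^ M * (1 / 2) ^ Suc m"
        for m
        using frechet_term_bounds(2)[OF p, of "m + M" "m + M"]
        by (simp only: power_add[symmetric] add_Suc_right add.commute[of M])
      show "summable (\<lambda>m. (1 / 2) ^ Suc (m + M) * (p (m + M) / (1 + p (m + M))))"
        using summable_ignore_initial_segment[OF frechet_summable[OF p], of M] .
    qed (rule sums_summable[OF sh])
    also have "\<dots> = (1 / 2) ^ M"
      using sums_unique[OF sh] by simp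
    finally show ?thesis .
  qed
  moreover have "(\<Sum>m<M. (1 / 2) ^ Suc m * (p m / (1 + p m))) \<le> \<delta>"
  proof -
    have "(\<Sum>m<M. (1 / 2) ^ Suc m * (p m / (1 + p m))) \<le> (\<Sum>m<M. (1 / 2) ^ Suc m * \<delta>)"
    proof (intro sum_mono mult_left_mono)
      fix m assume "m \<in> {..<M}"
      have "p m / (1 + p m) \<le> p m"
        using p[of m] by (simp add: field_simps)
      then show "p m / (1 + p m) \<le> \<delta>"
        using M[of m] \<open>m \<in> {..<M}\<close> by simp
    qed simp
    also have "\<dots> \<le> 1 * \<delta>"
      unfolding sum_distrib_right[symmetric]
      using sum_le_suminf[OF sums_summable[OF half], of "{..<M}"] sums_unique[OF half]
      by (intro mult_right_mono \<delta>) simp_all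
    finally show ?thesis by simp
  qed
  ultimately show ?thesis by simp
qed

section \<open>The metric axioms on \<open>Hol\<close>\<close>

lemma Hol_dist_eq:
  "f \<in> Hol \<Longrightarrow> g \<in> Hol \<Longrightarrow> Hol_dist r f g = frechet_sum (\<lambda>m. rho_at (r m) f g)"
  by (simp add: Hol_dist_def rho_def frechet_sum_def)

lemma Metric_space_Hol:
  fixes r :: "nat \<Rightarrow> real"
  assumes r: "\<And>m. 0 < r m \<and> r m < 1" and lim: "r \<longlonglongrightarrow> 1"
  shows "Metric_space (Hol :: ('h::complex_hilbert, 'n::finite) op_fun set) (Hol_dist r)"
proof
  have r': "0 \<le> r m" "r m < 1" for m using r[of m] by auto
  fix f g h :: "('h, 'n) op_fun"
  show "0 \<le> Hol_dist r f g"
  proof (cases "f \<in> Hol \<and> g \<in> Hol")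
    case True
    then show ?thesis
      by (auto simp: Hol_dist_eq intro!: frechet_sum_nonneg rho_at_nonneg r')
  qed (auto simp: Hol_dist_def)
  show "Hol_dist r f g = Hol_dist r g f"
    by (simp add: Hol_dist_def rho_def rho_at_commute[of _ f g])
  show "Hol_dist r f g = 0 \<longleftrightarrow> f = g" if fg: "f \<in> Hol" "g \<in> Hol"
  proof
    assume "f = g"
    then have "rho_at (r m) f g = 0" for m
      using zero_in_op_cball[OF r'(1)] by (auto simp: rho_at_def intro!: cSUP_const)
    then show "Hol_dist r f g = 0"
      by (simp add: Hol_dist_eq[OF fg] frechet_sum_def)
  next
    assume 0: "Hol_dist r f g = 0"
    have nn: "0 \<le> rho_at (r m) f g" for m
      by (intro rho_at_nonneg r' fg)
    have small: "rho_at (r m) f g < \<epsilon>" if "0 < \<epsilon>" for m \<epsilon>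
      by (rule frechet_sum_less_imp[where p = "\<lambda>m. rho_at (r m) f g", OF nn that])
        (use 0 that in \<open>simp add: Hol_dist_eq[OF fg]\<close>)
    \<comment> \<open>Since the radii tend to \<open>1\<close>, every point of the open ball lies in
      one of the closed balls seen by the metric.\<close>
    have "f X = g X" if X: "X \<in> op_ball" for X
    proof -
      have "\<forall>\<^sub>F m in sequentially. row_norm X < r m"
        using X by (intro order_tendstoD(1)[OF lim]) (simp add: op_ball_def)
      then obtain m where "row_norm X < r m"
        by (auto simp: eventually_sequentially)
      then have Xm: "X \<in> op_cball (r m)"
        using X by (simp add: op_ball_def op_cball_def)
      have "norm (f X - g X) < \<epsilon>" if "0 < \<epsilon>" for \<epsilon>
        using norm_diff_le_rho_at[OF r' fg Xm] small[OF that, of m] by simp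
      then show ?thesis
        by (metis eq_iff_diff_eq_0 less_irrefl zero_less_norm_iff)
    qed
    \<comment> \<open>Agreement on the ball suffices, because both functions are
      \<open>undefined\<close> elsewhere.\<close>
    then show "f = g"
      using fg unfolding Hol_def by (auto intro: PiE_ext)
  qed
  show "Hol_dist r f h \<le> Hol_dist r f g + Hol_dist r g h" if "f \<in> Hol" "g \<in> Hol" "h \<in> Hol"
    using that by (auto simp: Hol_dist_eq intro!: frechet_sum_triangle rho_at_nonneg rho_at_triangle r')
qed

subsection \<open>Completeness\<close>

lemma rho_at_le_of_Hol_dist:
  assumes r: "\<And>m. 0 < r m \<and> r m < 1" and fg: "f \<in> Hol" "g \<in> Hol" and \<epsilon>: "0 < \<epsilon>"
    and "Hol_dist r f g < (1 / 2) ^ Suc m * (\<epsilon> / (1 + \<epsilon>))"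
  shows "rho_at (r m) f g < \<epsilon>"
  by (rule frechet_sum_less_imp[of "\<lambda>m. rho_at (r m) f g"])
    (use assms in \<open>auto simp: Hol_dist_eq[OF fg] less_imp_le intro!: rho_at_nonneg\<close>)

text \<open>Increasing radii make the \<open>M\<close>-th seminorm dominate the earlier ones, so it
  controls the distance up to the tail of the weights.\<close>

lemma Hol_dist_le_rho_at:
  assumes r: "\<And>m. 0 < r m \<and> r m < 1" and inc: "incseq r" and fg: "f \<in> Hol" "g \<in> Hol"
  shows "Hol_dist r f g \<le> rho_at (r M) f g + (1 / 2) ^ M"
  unfolding Hol_dist_eq[OF fg]
proof (rule frechet_sum_le)
  have r': "0 \<le> r m" "r m < 1" for m using r[of m] by auto
  show "0 \<le> rho_at (r m) f g" for m
    by (intro rho_at_nonneg r' fg)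
  show "0 \<le> rho_at (r M) f g"
    by (intro rho_at_nonneg r' fg)
  show "rho_at (r m) f g \<le> rho_at (r M) f g" if "m < M" for m
    using that by (intro rho_at_mono r' fg incseqD[OF inc]) simp
qed

lemma half_power_less:
  assumes "0 < (\<epsilon> :: real)"
  obtains M where "(1 / 2) ^ M < \<epsilon>"
  using real_arch_pow_inv[OF assms, of "1 / 2"] by auto

lemma mcomplete_Hol:
  fixes r :: "nat \<Rightarrow> real"
  assumes inf: "\<not> (\<exists>B::'h::complex_hilbert set. finite B \<and> complex_vector.span B = UNIV)"
    and inc: "incseq r" and r: "\<And>m. 0 < r m \<and> r m < 1" and lim: "r \<longlonglongrightarrow> 1"
  shows "Metric_space.mcomplete (Hol :: ('h, 'n::finite) op_fun set) (Hol_dist r)"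
proof -
  interpret Metric_space "Hol :: ('h, 'n) op_fun set" "Hol_dist r"
    by (rule Metric_space_Hol[OF r lim])
  have r': "0 \<le> r m" "r m < 1" for m using r[of m] by auto
  have larger: "\<exists>m. s < r m" if "s < 1" for s
    using order_tendstoD(1)[OF lim that] by (auto simp: eventually_sequentially)
  show ?thesis
    unfolding mcomplete_def
  proof (intro allI impI)
    fix \<sigma> :: "nat \<Rightarrow> ('h, 'n) op_fun" assume cau: "MCauchy \<sigma>"
    then have \<sigma>: "\<sigma> j \<in> Hol" for j
      by (auto simp: MCauchy_def)
    then have "\<exists>a. has_free_series (\<sigma> j) a" for j
      by (auto simp: Hol_def)
    then obtain a where a: "\<And>j. has_free_series (\<sigma> j) (a j)"
      by metis
    \<comment> \<open>The Cauchy property passes to the weighted coefficient norms, uniformly in the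
      word length \<open>k\<close>.\<close>
    have cau_norm: "\<exists>J. \<forall>i\<ge>J. \<forall>j\<ge>J. \<forall>k. r m ^ k * word_norm (\<lambda>\<alpha>. a i \<alpha> - a j \<alpha>) k \<le> \<epsilon>"
      if \<epsilon>: "0 < \<epsilon>" for m \<epsilon>
    proof -
      have "0 < (1 / 2) ^ Suc m * (\<epsilon> / (1 + \<epsilon>))"
        using \<epsilon> by simp
      then obtain J where J: "\<And>i j. i \<ge> J \<Longrightarrow> j \<ge> J \<Longrightarrow>
          Hol_dist r (\<sigma> i) (\<sigma> j) < (1 / 2) ^ Suc m * (\<epsilon> / (1 + \<epsilon>))"
        using cau unfolding MCauchy_def by meson
      have "r m ^ k * word_norm (\<lambda>\<alpha>. a i \<alpha> - a j \<alpha>) k \<le> \<epsilon>" if "i \<ge> J" "j \<ge> J" for i j k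
        using word_norm_le_rho_at[OF r' inf \<sigma> \<sigma> a a, of m k i j]
          rho_at_le_of_Hol_dist[OF r \<sigma> \<sigma> \<epsilon> J[OF that]] by simp
      then show ?thesis by blast
    qed
    have "Cauchy (\<lambda>j. a j \<alpha>)" for \<alpha>
    proof (rule metric_CauchyI)
      fix \<epsilon> :: real assume \<epsilon>: "0 < \<epsilon>"
      let ?k = "length \<alpha>"
      \<comment> \<open>Any fixed radius serves for a single coefficient; the threshold carries the
        factor \<open>r 0 ^ ?k\<close> that is cancelled below.\<close>
      have "0 < r 0 ^ ?k * (\<epsilon> / 2)"
        using r[of 0] \<epsilon> by simp
      then obtain J where J: "\<And>i j k. i \<ge> J \<Longrightarrow> j \<ge> J \<Longrightarrow>
          r 0 ^ k * word_norm (\<lambda>\<alpha>. a i \<alpha> - a j \<alpha>) k \<le> r 0 ^ ?k * (\<epsilon> / 2)"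
        using cau_norm by meson
      have "dist (a i \<alpha>) (a j \<alpha>) < \<epsilon>" if "i \<ge> J" "j \<ge> J" for i j
      proof -
        have "word_norm (\<lambda>\<alpha>. a i \<alpha> - a j \<alpha>) ?k \<le> \<epsilon> / 2"
          using J[OF that, of ?k] r[of 0] by (simp del: times_divide_eq_right)
        then show ?thesis
          using norm_coeff_le_word_norm[of "\<lambda>\<alpha>. a i \<alpha> - a j \<alpha>" \<alpha>] \<epsilon> by (simp add: dist_norm)
      qed
      then show "\<exists>J. \<forall>i\<ge>J. \<forall>j\<ge>J. dist (a i \<alpha>) (a j \<alpha>) < \<epsilon>"
        by blast
    qed
    then have "\<exists>c. (\<lambda>j. a j \<alpha>) \<longlonglongrightarrow> c" for \<alpha>
      by (simp add: Cauchy_convergent_iff convergent_def)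
    then obtain b where b: "\<And>\<alpha>. (\<lambda>j. a j \<alpha>) \<longlonglongrightarrow> b \<alpha>"
      by metis
    \<comment> \<open>With \<open>j\<close> fixed, the other index tends to infinity in
      \<open>cau_norm\<close>. The same \<open>J\<close> works for all \<open>k\<close>, so
      uniformity in \<open>k\<close> survives.\<close>
    have lim_norm: "\<exists>J. \<forall>j\<ge>J. \<forall>k. r m ^ k * word_norm (\<lambda>\<alpha>. a j \<alpha> - b \<alpha>) k \<le> \<epsilon>"
      if \<epsilon>: "0 < \<epsilon>" for m \<epsilon>
    proof -
      obtain J where J: "\<And>i j k. i \<ge> J \<Longrightarrow> j \<ge> J \<Longrightarrow>
          r m ^ k * word_norm (\<lambda>\<alpha>. a i \<alpha> - a j \<alpha>) k \<le> \<epsilon>"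
        using cau_norm[OF \<epsilon>] by meson
      have "r m ^ k * word_norm (\<lambda>\<alpha>. a j \<alpha> - b \<alpha>) k \<le> \<epsilon>" if "j \<ge> J" for j k
      proof (rule LIMSEQ_le_const2)
        show "(\<lambda>i. r m ^ k * word_norm (\<lambda>\<alpha>. a j \<alpha> - a i \<alpha>) k)
            \<longlonglongrightarrow> r m ^ k * word_norm (\<lambda>\<alpha>. a j \<alpha> - b \<alpha>) k"
          by (intro tendsto_intros tendsto_word_norm b)
      qed (use J that in blast)
      then show ?thesis by blast
    qed
    \<comment> \<open>The limit inherits the growth condition from one member \<open>a J\<close>,
      from which it differs by at most \<open>1\<close> in the weighted norms at a radius
      \<open>r m\<close> beyond \<open>s\<close>.\<close>
    have bc: "ball_coeffs b"
      unfolding ball_coeffs_def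
    proof (intro allI impI)
      fix s :: real assume s: "0 < s \<and> s < 1"
      then obtain m where m: "s < r m"
        using larger by blast
      obtain J where J: "\<And>k. r m ^ k * word_norm (\<lambda>\<alpha>. a J \<alpha> - b \<alpha>) k \<le> 1"
        using lim_norm[of 1 m] by auto
      obtain C where C: "\<And>k. r m ^ k * word_norm (a J) k \<le> C"
        using a[of J] r[of m] unfolding has_free_series_iff ball_coeffs_def by meson
      have "s ^ k * word_norm b k \<le> C + 1" for k
      proof -
        have "s ^ k * word_norm b k
            \<le> r m ^ k * (word_norm (a J) k + word_norm (\<lambda>\<alpha>. a J \<alpha> - b \<alpha>) k)"
          using word_norm_diff[of "a J" "\<lambda>\<alpha>. a J \<alpha> - b \<alpha>" k] s m
          by (intro mult_mono power_mono) simp_all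
        then show ?thesis
          using C[of k] J[of k] by (simp add: distrib_left)
      qed
      then show "\<exists>C. \<forall>k. s ^ k * word_norm b k \<le> C"
        by blast
    qed
    define f :: "('h, 'n) op_fun" where "f = free_function b"
    have f: "f \<in> Hol" "has_free_series f b"
      unfolding f_def using bc by (rule free_function_in_Hol, rule has_free_series_free_function)
    have "\<exists>J. \<forall>j\<ge>J. Hol_dist r (\<sigma> j) f < \<epsilon>" if \<epsilon>: "0 < \<epsilon>" for \<epsilon>
    proof -
      obtain M where M: "(1 / 2) ^ M < \<epsilon> / 2"
        using half_power_less[of "\<epsilon> / 2"] \<epsilon> by auto
      \<comment> \<open>Returning from coefficients to suprema loses radius: bounds at
        \<open>r m\<close> control the seminorm at \<open>r M\<close>, at the cost of the factor
        \<open>K\<close>.\<close>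
      obtain m where m: "r M < r m"
        using larger r' by blast
      define K where "K = r m / (r m - r M)"
      have K: "0 < K"
        using m r[of m] by (simp add: K_def)
      \<comment> \<open>With this bound the seminorm is at most \<open>\<epsilon> / 2\<close>, and
        the tail of the weights takes the other half.\<close>
      then have "0 < \<epsilon> / (2 * K)"
        using \<epsilon> by simp
      then obtain J where J: "\<And>j k. j \<ge> J \<Longrightarrow>
          r m ^ k * word_norm (\<lambda>\<alpha>. a j \<alpha> - b \<alpha>) k \<le> \<epsilon> / (2 * K)"
        using lim_norm by meson
      have "Hol_dist r (\<sigma> j) f < \<epsilon>" if "j \<ge> J" for j
      proof -
        have "rho_at (r M) (\<sigma> j) f \<le> \<epsilon> / (2 * K) * K"
          unfolding K_def by (rule rho_at_le_word_norm[OF r' a f(2) m])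
            (use J[OF that] in \<open>simp add: K_def\<close>)
        then show ?thesis
          using Hol_dist_le_rho_at[OF r inc \<sigma> f(1), of j M] M K by simp
      qed
      then show ?thesis by blast
    qed
    then have "limitin mtopology \<sigma> f sequentially"
      by (simp add: limit_metric_sequentially \<sigma> f(1))
    then show "\<exists>g. limitin mtopology \<sigma> g sequentially"
      by (intro exI[where x = f])
  qed
qed

subsection \<open>Hausdorff derivations\<close>

lemma series_deriv_Nil: "series_deriv i a [] = a [i]"
proof -
  have "series_deriv i a [] = (\<Sum>j\<in>UNIV. if j = i then a [i] else 0)"
    unfolding series_deriv_def list.size(3) sum_words_Suc
    by (intro sum.cong refl) (auto simp: nc_monom_def[of "[]"])
  then show ?thesis by simp
qed

text \<open>A deletion of one letter \<open>i\<close> that leaves \<open>x # \<gamma>\<close> either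
  removes the first letter of \<open>i # x # \<gamma>\<close>, or keeps an initial \<open>x\<close>
  and removes a later letter.\<close>

lemma series_deriv_Cons:
  "series_deriv i a (x # \<gamma>) = a (i # x # \<gamma>) + series_deriv i (\<lambda>\<beta>. a (x # \<beta>)) \<gamma>"
proof -
  let ?W = "{\<beta> :: 'a list. length \<beta> = Suc (length \<gamma>)}"
  have nc_monom_app: "nc_monom \<beta> \<delta> = (if \<beta> = \<delta> then 1 else 0)" for \<beta> \<delta> :: "'a list"
    by (auto simp: nc_monom_def)
  have "series_deriv i a (x # \<gamma>) =
      (\<Sum>j\<in>UNIV. \<Sum>\<beta>\<in>?W. (if j = i then if \<beta> = x # \<gamma> then a (i # x # \<gamma>) else 0 else 0)
        + (if j = x then a (x # \<beta>) * word_deriv i \<beta> \<gamma> else 0))"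
    unfolding series_deriv_def length_Cons sum_words_Suc
    by (intro sum.cong refl) (auto simp: nc_monom_app distrib_left)
  also have "\<dots> = (\<Sum>j\<in>UNIV. (if j = i then \<Sum>\<beta>\<in>?W. if \<beta> = x # \<gamma> then a (i # x # \<gamma>) else 0 else 0)
        + (if j = x then series_deriv i (\<lambda>\<beta>. a (x # \<beta>)) \<gamma> else 0))"
    by (intro sum.cong refl) (simp add: sum.distrib series_deriv_def)
  also have "\<dots> = a (i # x # \<gamma>) + series_deriv i (\<lambda>\<beta>. a (x # \<beta>)) \<gamma>"
    by (simp add: sum.distrib finite_words)
  finally show ?thesis .
qed

lemma series_deriv_diff:
  "series_deriv i (\<lambda>\<alpha>. a \<alpha> - b \<alpha>) = (\<lambda>\<beta>. series_deriv i a \<beta> - series_deriv i b \<beta>)"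
  by (simp add: series_deriv_def left_diff_distrib sum_subtractf)

lemma word_norm_Cons_le: "word_norm (\<lambda>\<beta>. a (i # \<beta>)) k \<le> word_norm a (Suc k)"
  unfolding word_norm_Suc by (rule member_le_L2_set) simp_all

text \<open>The letter can be deleted at \<open>k + 1\<close> places, each contributing at most
  \<open>word_norm a (Suc k)\<close>. The induction treats deletion of the first letter separately
  and leaves later deletions to the series of the tails after each first letter
  \<open>x\<close>.\<close>

lemma word_norm_series_deriv:
  "word_norm (series_deriv i a) k \<le> real (Suc k) * word_norm a (Suc k)"
proof (induction k arbitrary: a)
  case 0
  have "word_norm (series_deriv i a) 0 = cmod (a [i])"
    by (simp add: word_norm_def series_deriv_Nil)
  then show ?case
    using norm_coeff_le_word_norm[of a "[i]"] by simp
next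
  case (Suc k)
  have "word_norm (series_deriv i a) (Suc k)
      = L2_set (\<lambda>x. word_norm (\<lambda>\<gamma>. a (i # x # \<gamma>) + series_deriv i (\<lambda>\<beta>. a (x # \<beta>)) \<gamma>) k) UNIV"
    by (simp add: word_norm_Suc series_deriv_Cons)
  also have "\<dots> \<le> L2_set (\<lambda>x. word_norm (\<lambda>\<gamma>. a (i # x # \<gamma>)) k
      + word_norm (series_deriv i (\<lambda>\<beta>. a (x # \<beta>))) k) UNIV"
    by (intro L2_set_mono word_norm_add) simp
  also have "\<dots> \<le> L2_set (\<lambda>x. word_norm (\<lambda>\<gamma>. a (i # x # \<gamma>)) k) UNIV
      + L2_set (\<lambda>x. word_norm (series_deriv i (\<lambda>\<beta>. a (x # \<beta>))) k) UNIV"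
    by (rule L2_set_triangle_ineq)
  also have "\<dots> \<le> word_norm a (Suc (Suc k))
      + L2_set (\<lambda>x. real (Suc k) * word_norm (\<lambda>\<beta>. a (x # \<beta>)) (Suc k)) UNIV"
    using word_norm_Cons_le[of a i "Suc k"]
    by (intro add_mono L2_set_mono Suc.IH) (simp_all add: word_norm_Suc[of "\<lambda>\<beta>. a (i # \<beta>)"])
  \<comment> \<open>The norms of the tails after all first letters reassemble to the norm of
    \<open>a\<close>.\<close>
  also have "\<dots> = word_norm a (Suc (Suc k)) + real (Suc k) * word_norm a (Suc (Suc k))"
    by (simp add: word_norm_Suc[of a "Suc k"] L2_set_right_distrib del: of_nat_Suc)
  also have "\<dots> = real (Suc (Suc k)) * word_norm a (Suc (Suc k))"
    by (simp add: algebra_simps)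
  finally show ?case .
qed

text \<open>The factor \<open>k + 1\<close> is absorbed by the decay of \<open>(t / u) ^ k\<close>.
  One constant serves all series at once, on which the continuity proof relies.\<close>

lemma series_deriv_estimate:
  assumes "0 < t" "t < (u :: real)"
  obtains K where "0 < K" and
    "\<And>(a :: 'n::finite ncseries) C k. (\<And>k. u ^ k * word_norm a k \<le> C) \<Longrightarrow>
      t ^ k * word_norm (series_deriv i a) k \<le> K * C"
proof -
  define z where "z = t / u"
  have z: "0 \<le> z" "z < 1" "0 < u" using assms by (simp_all add: z_def)
  have "(\<lambda>k. of_nat k * z ^ k + z ^ k) \<longlonglongrightarrow> 0 + 0"
    using z by (intro tendsto_add powser_times_n_limit_0 LIMSEQ_realpow_zero) simp_all
  then have "Bseq (\<lambda>k. of_nat k * z ^ k + z ^ k)"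
    using convergentI convergent_imp_Bseq by blast
  then obtain L where L: "0 < L" "\<And>k. norm (of_nat k * z ^ k + z ^ k) \<le> L"
    by (auto elim: BseqE)
  have "t ^ k * word_norm (series_deriv i a) k \<le> L / u * C"
    if C: "\<And>k. u ^ k * word_norm a k \<le> C" for a :: "'n ncseries" and C k
  proof -
    have C0: "0 \<le> C" by (rule order_trans[OF _ C[of 0]]) simp
    have "t ^ k * word_norm (series_deriv i a) k \<le> t ^ k * (real (Suc k) * word_norm a (Suc k))"
      using assms by (intro mult_left_mono word_norm_series_deriv) simp
    \<comment> \<open>The index shift from \<open>k\<close> to \<open>Suc k\<close> costs one power
      of \<open>u\<close>, hence the division by \<open>u\<close>.\<close>
    also have "\<dots> = (of_nat k * z ^ k + z ^ k) / u * (u ^ Suc k * word_norm a (Suc k))"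
      using z(3) by (simp add: z_def power_divide field_simps)
    also have "\<dots> \<le> L / u * C"
      using L(2)[of k] L(1) z C0 by (intro mult_mono divide_right_mono C) simp_all
    finally show ?thesis .
  qed
  then show thesis
    using L(1) z(3) by (intro that[of "L / u"]) simp_all
qed

lemma ball_coeffs_series_deriv:
  assumes "ball_coeffs a"
  shows "ball_coeffs (series_deriv i a)"
  unfolding ball_coeffs_def
proof (intro allI impI)
  fix t :: real assume t: "0 < t \<and> t < 1"
  then obtain u where u: "t < u" "u < 1" using dense by blast
  then have "0 < u" using t by simp
  then obtain C where C: "\<And>k. u ^ k * word_norm a k \<le> C"
    using assms u unfolding ball_coeffs_def by meson
  obtain K where "\<And>(a :: 'a ncseries) C k. (\<And>k. u ^ k * word_norm a k \<le> C) \<Longrightarrow>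
      t ^ k * word_norm (series_deriv i a) k \<le> K * C"
    using series_deriv_estimate[of t u] t u by metis
  from this[OF C] show "\<exists>C. \<forall>k. t ^ k * word_norm (series_deriv i a) k \<le> C"
    by blast
qed

lemma continuous_map_hausdorff_deriv:
  fixes r :: "nat \<Rightarrow> real" and i :: "'n::finite"
  assumes inf: "\<not> (\<exists>B::'h::complex_hilbert set. finite B \<and> complex_vector.span B = UNIV)"
    and inc: "incseq r" and r: "\<And>m. 0 < r m \<and> r m < 1" and lim: "r \<longlonglongrightarrow> 1"
  shows "continuous_map
    (Metric_space.mtopology (Hol :: ('h, 'n) op_fun set) (Hol_dist r))
    (Metric_space.mtopology (Hol :: ('h, 'n) op_fun set) (Hol_dist r)) (hausdorff_deriv i)"
proof -
  interpret Metric_space "Hol :: ('h, 'n) op_fun set" "Hol_dist r"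
    by (rule Metric_space_Hol[OF r lim])
  have r': "0 \<le> r m" "r m < 1" for m using r[of m] by auto
  \<comment> \<open>Uniqueness of coefficients identifies the derivative, defined through
    \<open>free_coeffs\<close>, with the function of the differentiated series.\<close>
  have series: "hausdorff_deriv i f \<in> Hol" "has_free_series (hausdorff_deriv i f) (series_deriv i a)"
    if "has_free_series f a" for f :: "('h, 'n) op_fun" and a
  proof -
    have "ball_coeffs (series_deriv i a)"
      using that by (intro ball_coeffs_series_deriv) (simp add: has_free_series_iff)
    moreover have "hausdorff_deriv i f = free_function (series_deriv i a)"
      by (simp add: hausdorff_deriv_def free_function_def free_coeffs_eq[OF inf that])
    ultimately show "hausdorff_deriv i f \<in> Hol"
      and "has_free_series (hausdorff_deriv i f) (series_deriv i a)"
      by (simp_all add: free_function_in_Hol has_free_series_free_function)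
  qed
  show ?thesis
    unfolding metric_continuous_map[OF Metric_space_axioms]
  proof (intro conjI ballI allI impI)
    show "hausdorff_deriv i ` (Hol :: ('h, 'n) op_fun set) \<subseteq> Hol"
      using series(1) by (auto elim: Hol_free_series)
    fix f :: "('h, 'n) op_fun" and \<epsilon> :: real assume f: "f \<in> Hol" and \<epsilon>: "0 < \<epsilon>"
    obtain M where M: "(1 / 2) ^ M < \<epsilon> / 2"
      using half_power_less[of "\<epsilon> / 2"] \<epsilon> by auto
    obtain m where m: "r M < r m"
      using order_tendstoD(1)[OF lim r'(2)] by (auto simp: eventually_sequentially)
    \<comment> \<open>Radius is lost twice: the derivation costs the step from \<open>r m\<close> to
      \<open>t\<close>, and summing the series costs the step from \<open>t\<close> to
      \<open>r M\<close>.\<close>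
    obtain t where t: "r M < t" "t < r m"
      using dense[OF m] by blast
    have t0: "0 < t" using t(1) r[of M] by simp
    obtain K where K: "0 < K" and deriv: "\<And>(a :: 'n ncseries) C k.
        (\<And>k. r m ^ k * word_norm a k \<le> C) \<Longrightarrow> t ^ k * word_norm (series_deriv i a) k \<le> K * C"
      using series_deriv_estimate[OF t0 t(2)] by metis
    define L where "L = K * (t / (t - r M))"
    have L: "0 < L" using K t t0 by (simp add: L_def)
    \<comment> \<open>Chosen so that the seminorm of the difference of the derivatives is at most
      \<open>\<epsilon> / 2\<close>, the other half being left for the tail of the weights.\<close>
    define \<eta> where "\<eta> = \<epsilon> / (2 * L)"
    have \<eta>: "0 < \<eta>" using \<epsilon> L by (simp add: \<eta>_def)
    have "Hol_dist r (hausdorff_deriv i f) (hausdorff_deriv i g) < \<epsilon>"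
      if g: "g \<in> Hol" and dist: "Hol_dist r f g < (1 / 2) ^ Suc m * (\<eta> / (1 + \<eta>))" for g
    proof -
      obtain a b where a: "has_free_series f a" and b: "has_free_series g b"
        using f g by (meson Hol_free_series)
      have "t ^ k * word_norm (\<lambda>\<alpha>. series_deriv i a \<alpha> - series_deriv i b \<alpha>) k
          \<le> K * rho_at (r m) f g" for k
        using deriv[OF word_norm_le_rho_at[OF r' inf f g a b]] by (simp add: series_deriv_diff)
      then have "rho_at (r M) (hausdorff_deriv i f) (hausdorff_deriv i g)
          \<le> K * rho_at (r m) f g * (t / (t - r M))"
        by (rule rho_at_le_word_norm[OF r' series(2)[OF a] series(2)[OF b] t(1)])
      also have "\<dots> = L * rho_at (r m) f g"
        by (simp add: L_def)
      also have "\<dots> \<le> L * \<eta>"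
        using rho_at_le_of_Hol_dist[OF r f g \<eta> dist] L by simp
      also have "\<dots> = \<epsilon> / 2"
        using L by (simp add: \<eta>_def)
      finally show ?thesis
        using Hol_dist_le_rho_at[OF r inc series(1)[OF a] series(1)[OF b], of M] M by simp
    qed
    moreover have "0 < (1 / 2) ^ Suc m * (\<eta> / (1 + \<eta>))"
      using \<eta> by simp
    ultimately show "\<exists>\<delta>>0. \<forall>g. g \<in> Hol \<and> Hol_dist r f g < \<delta> \<longrightarrow>
        Hol_dist r (hausdorff_deriv i f) (hausdorff_deriv i g) < \<epsilon>"
      by blast
  qed
qed

theorem theorem5p6:
  fixes r :: "nat \<Rightarrow> real"
  assumes "\<not> (\<exists>B::'h::complex_hilbert set. finite B \<and> complex_vector.span B = UNIV)"
    and "incseq r" and "\<And>m. 0 < r m \<and> r m < 1" and "r \<longlonglongrightarrow> 1"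
  shows "Metric_space (Hol :: ('h, 'n::finite) op_fun set) (Hol_dist r)
    \<and> Metric_space.mcomplete (Hol :: ('h, 'n) op_fun set) (Hol_dist r)
    \<and> (\<forall>i::'n. continuous_map
          (Metric_space.mtopology (Hol :: ('h, 'n) op_fun set) (Hol_dist r))
          (Metric_space.mtopology (Hol :: ('h, 'n) op_fun set) (Hol_dist r))
          (hausdorff_deriv i))"
  using Metric_space_Hol[OF assms(3,4)] mcomplete_Hol[OF assms]
    continuous_map_hausdorff_deriv[OF assms] by blast

end
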